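(* Let $\{x_t\},\{\widetilde x_t\},\{\bar x_t\},\{y_t\}$ be generated by the AC-APDHG iteration (defined in the context) with $\mu_d>0$, $\eta_1>0$, $\beta_1=0$, $\beta_t=\beta$ for $t\ge2$ with $\beta\in(0,1-\frac{\sqrt6}{3}]$, $\tau_1=0$, $\tau_2=\mu_d$, $\widetilde\tau_1=0$, $\widetilde\tau_2=1$, $\eta_2=\min\{(1-\beta)\eta_1,\frac1{4L_{A,1}^2/\mu_d+4L_{f,1}}\}$, and for $t\ge3$ $$\eta_t=\min\Big\{\tfrac43\eta_{t-1},\ \frac{\tau_{t-2}+\mu_d}{\tau_{t-1}}\eta_{t-1},\ \frac{\tau_{t-1}}{4\mu_dL_{f,t-1}+4L_{A,t-1}^2}\Big\},$$ $$\tau_t=\tau_{t-1}+\frac{\mu_d}{2}\Big[\alpha+(1-\alpha)\eta_t\cdot\frac{4\mu_dL_{f,t-1}+4L_{A,t-1}^2}{\tau_{t-1}}\Big],\qquad\widetilde\tau_t=\frac{\tau_t}{\mu_d},$$ where $\alpha\in(0,1]$ is an absolute constant. Then for all $t\ge2$, $$\eta_t\ge\frac{3+\alpha(t-3)}{12\widehat L_{t-1}},\qquad\text{where }\widehat L_t:=\max\Big\{\frac1{4(1-\beta)\eta_1},\ \frac{L_{A,1}^2}{\mu_d}+L_{f,1},\dots,\frac{L_{A,t}^2}{\mu_d}+L_{f,t}\Big\}.$$ Consequently, for every $k\ge2$ and $z=(x,y)\in Z$, $$Q(\widehat z_k,z)-\frac{\mu_d}{2}\|\widetilde y_0-y\|^2+\frac{\mu_d}{2}\|\widetilde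 y_0-\widehat y_k\|^2+\frac{\mu_d}{2}\|\widetilde y_k-y\|^2$$ $$\le\frac{12\widehat L_k}{6k+\alpha k(k-3)}\Big[\frac{\|x_0-x\|^2-\|\bar x_{k+1}-x\|^2}{\beta}+\eta_2\Big(\frac{5L_{A,1}^2}{2\mu_d}+\frac{5L_{f,1}}{2}-\frac1{\eta_1}\Big)\|x_1-x_0\|^2\Big].$$ Moreover, if $\max_{x\in X}\|x-x_0\|^2\le D_X^2$ and $\max_{y\in Y}\|y-\widetilde y_0\|^2\le D_Y^2$, then for every $k\ge2$ $$\max_{z\in Z}Q(\widehat z_k,z)\le\frac{12\widehat L_k}{6k+\alpha k(k-3)}\Big(\frac1\beta+\frac58\Big)D_X^2+\frac{\mu_d}{2}D_Y^2.$$ Here $$\widehat x_k=\frac{\sum_{t=1}^k\eta_{t+1}x_t}{\sum_{t=1}^k\eta_{t+1}},\quad \widehat y_k=\frac{\sum_{t=1}^k\eta_{t+1}y_t}{\sum_{t=1}^k\eta_{t+1}},\quad \widehat z_k=(\widehat x_k,\widehat y_k),$$ $$\widetilde y_k=\frac{\sum_{t=1}^{k-1}\big(\eta_{t+1}(\mu_d+\tau_t)-\eta_{t+2}\tau_{t+1}\big)y_t+\eta_{k+1}(\mu_d+\tau_k)y_k}{\mu_d\sum_{t=1}^k\eta_{t+1}}.$$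
   Context: Setting: $X\subseteq\mathbb{R}^n$ and $Y\subseteq\mathbb{R}^m$ are nonempty closed convex sets, $Z=X\times Y$, $A\in\mathbb{R}^{m\times n}$, $g:Y\to\mathbb{R}$ is proper, lower semicontinuous, convex, and $f:X\to\mathbb{R}$ is a differentiable convex function satisfying, for some $L_f>0$ and all $x,y\in X$, $\frac1{2L_f}\|\nabla f(x)-\nabla f(y)\|^2\le f(y)-f(x)-\langle\nabla f(x),y-x\rangle\le\frac{L_f}{2}\|x-y\|^2$. Norms are Euclidean. The problem $\min_{x\in X}\max_{y\in Y}f(x)+\langle Ax,y\rangle-g(y)$ is assumed to have a saddle point. For $\bar z=(\bar x,\bar y)\in Z$ and $z=(x,y)\in Z$, $Q(\bar z,z)=f(\bar x)+\langle A\bar x,y\rangle-g(y)-[f(x)+\langle Ax,\bar y\rangle-g(\bar y)]$. AC-APDHG iteration: given $x_0=\widetilde x_0=\bar x_0\in X$, $\widetilde y_0\in Y$, $\mu_d>0$ and parameters $\beta_t\in[0,1)$, $\eta_t$, $\tau_t$, $\widetilde\tau_t$, set $y_0=\arg\min_{y\in Y}\{\langle-Ax_0,y\rangle+g(y)+\frac{\mu_d}{2}\|\widetilde y_0-y\|^2\}$, and for $t=1,2,\dots$ - $x_t=\arg\min_{x\in X}\{\eta_t\langle A^\top y_{t-1}+\nabla f(\widetilde x_{t-1}),x\rangle+\frac12\|\bar x_{t-1}-x\|^2\}$, - $\bar x_t=(1-\beta_t)\bar x_{t-1}+\beta_tx_t$, - $\widetilde x_t=(x_t+\widetilde\tau_t\widetilde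 x_{t-1})/(1+\widetilde\tau_t)$, - $y_t=\arg\min_{y\in Y}\{\langle-Ax_t,y\rangle+g(y)+\frac{\mu_d}{2}\|\widetilde y_0-y\|^2+\frac{\tau_t}{2}\|y_{t-1}-y\|^2\}$. Local estimates: $L_{A,t}=\frac{\|A^\top(y_t-y_{t-1})\|}{\|y_t-y_{t-1}\|}$ for $t\ge1$; $L_{f,1}=\frac{\|\nabla f(\widetilde x_1)-\nabla f(\widetilde x_0)\|}{\|\widetilde x_1-\widetilde x_0\|}$; $L_{f,t}=\frac{\|\nabla f(\widetilde x_t)-\nabla f(\widetilde x_{t-1})\|^2}{2[f(\widetilde x_{t-1})-f(\widetilde x_t)-\langle\nabla f(\widetilde x_t),\widetilde x_{t-1}-\widetilde x_t\rangle]}$ for $t\ge2$. Conventions: $0/0=0$ and $a/0=+\infty$ for $a>0$.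
   Formalization: In the second inequality, when the bracket [...] is negative the factor 12L̂_k/(6k+αk(k-3)) is replaced by 1/(2∑_{t=1}^k η_{t+1}), since the printed bound fails there (e.g. f(x)=x, X=[0,100], Y={0}, A=0, g=0, x_0=10, x=100). *)

theory Defs
  imports "HOL-Analysis.Analysis"
begin

definition lsc_on :: "'a::topological_space set \<Rightarrow> ('a \<Rightarrow> real) \<Rightarrow> bool" where
  "lsc_on S g \<longleftrightarrow> (\<forall>y\<in>S. \<forall>r < g y. \<forall>\<^sub>F y' in at y within S. r < g y')"

(* The gradient of f on X is carried as a function df. Differentiability is relative to X, so
   nothing is required of f outside X (X may even have empty interior). *)
definition smooth_convex_on ::
  "real \<Rightarrow> (real^'n) set \<Rightarrow> (real^'n \<Rightarrow> real) \<Rightarrow> (real^'n \<Rightarrow> real^'n) \<Rightarrow> bool" where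
  "smooth_convex_on Lf X f df \<longleftrightarrow>
     convex_on X f \<and>
     (\<forall>x\<in>X. (f has_derivative (\<lambda>h. df x \<bullet> h)) (at x within X)) \<and>
     (\<forall>x\<in>X. \<forall>y\<in>X.
        1 / (2 * Lf) * (norm (df x - df y))\<^sup>2 \<le> f y - f x - df x \<bullet> (y - x) \<and>
        f y - f x - df x \<bullet> (y - x) \<le> Lf / 2 * (norm (x - y))\<^sup>2)"

definition saddle_point ::
  "(real^'n) set \<Rightarrow> (real^'m) set \<Rightarrow> (real^'n \<Rightarrow> real^'m \<Rightarrow> real) \<Rightarrow> real^'n \<Rightarrow> real^'m \<Rightarrow> bool" where
  "saddle_point X Y \<Phi> xs ys \<longleftrightarrow>
     xs \<in> X \<and> ys \<in> Y \<and> (\<forall>x\<in>X. \<forall>y\<in>Y. \<Phi> xs y \<le> \<Phi> xs ys \<and> \<Phi> xs ys \<le> \<Phi> x ys)"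

definition lagrangian ::
  "real^'n^'m \<Rightarrow> (real^'n \<Rightarrow> real) \<Rightarrow> (real^'m \<Rightarrow> real) \<Rightarrow> real^'n \<Rightarrow> real^'m \<Rightarrow> real" where
  "lagrangian A f g x y = f x + (A *v x) \<bullet> y - g y"

definition gap_Q ::
  "real^'n^'m \<Rightarrow> (real^'n \<Rightarrow> real) \<Rightarrow> (real^'m \<Rightarrow> real) \<Rightarrow>
   (real^'n) \<times> (real^'m) \<Rightarrow> (real^'n) \<times> (real^'m) \<Rightarrow> real" where
  "gap_Q A f g zb z =
     f (fst zb) + (A *v fst zb) \<bullet> snd z - g (snd z)
     - (f (fst z) + (A *v fst z) \<bullet> snd zb - g (snd zb))"

(* The iterates are indexed by nat; xt, xb, yt0 are the sequences/points written with a tilde or a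
   bar, tt is the sequence of tilde-tau parameters. Each argmin is a set-constrained minimiser;
   it is unique because the objectives are strongly convex. *)
definition ac_apdhg ::
  "(real^'n) set \<Rightarrow> (real^'m) set \<Rightarrow> real^'n^'m \<Rightarrow> (real^'n \<Rightarrow> real^'n) \<Rightarrow> (real^'m \<Rightarrow> real) \<Rightarrow>
   real \<Rightarrow> real^'m \<Rightarrow>
   (nat \<Rightarrow> real) \<Rightarrow> (nat \<Rightarrow> real) \<Rightarrow> (nat \<Rightarrow> real) \<Rightarrow> (nat \<Rightarrow> real) \<Rightarrow>
   (nat \<Rightarrow> real^'n) \<Rightarrow> (nat \<Rightarrow> real^'n) \<Rightarrow> (nat \<Rightarrow> real^'n) \<Rightarrow> (nat \<Rightarrow> real^'m) \<Rightarrow> bool" where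
  "ac_apdhg X Y A df g \<mu> yt0 \<beta> \<eta> \<tau> tt x xt xb y \<longleftrightarrow>
     x 0 \<in> X \<and> xt 0 = x 0 \<and> xb 0 = x 0 \<and> yt0 \<in> Y \<and>
     is_arg_min (\<lambda>v. - (A *v x 0) \<bullet> v + g v + \<mu> / 2 * (norm (yt0 - v))\<^sup>2) (\<lambda>v. v \<in> Y) (y 0) \<and>
     (\<forall>t\<ge>1.
        is_arg_min
          (\<lambda>u. \<eta> t * ((transpose A *v y (t - 1) + df (xt (t - 1))) \<bullet> u)
               + 1 / 2 * (norm (xb (t - 1) - u))\<^sup>2)
          (\<lambda>u. u \<in> X) (x t) \<and>
        xb t = (1 - \<beta> t) *\<^sub>R xb (t - 1) + \<beta> t *\<^sub>R x t \<and>
        xt t = (1 / (1 + tt t)) *\<^sub>R (x t + tt t *\<^sub>R xt (t - 1)) \<and>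
        is_arg_min
          (\<lambda>v. - (A *v x t) \<bullet> v + g v + \<mu> / 2 * (norm (yt0 - v))\<^sup>2
               + \<tau> t / 2 * (norm (y (t - 1) - v))\<^sup>2)
          (\<lambda>v. v \<in> Y) (y t))"

(* In both local estimates below, for points of X, the numerator vanishes whenever the denominator
   does (for Lf_loc with t \<ge> 2 this is the lower bound in smooth_convex_on). So only the convention
   0/0 = 0 is ever needed, and it agrees with division on real. *)
definition LA_loc :: "real^'n^'m \<Rightarrow> (nat \<Rightarrow> real^'m) \<Rightarrow> nat \<Rightarrow> real" where
  "LA_loc A y t = norm (transpose A *v (y t - y (t - 1))) / norm (y t - y (t - 1))"

definition Lf_loc ::
  "(real^'n \<Rightarrow> real) \<Rightarrow> (real^'n \<Rightarrow> real^'n) \<Rightarrow> (nat \<Rightarrow> real^'n) \<Rightarrow> nat \<Rightarrow> real" where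
  "Lf_loc f df xt t =
     (if t = 1 then norm (df (xt 1) - df (xt 0)) / norm (xt 1 - xt 0)
      else (norm (df (xt t) - df (xt (t - 1))))\<^sup>2 /
           (2 * (f (xt (t - 1)) - f (xt t) - df (xt t) \<bullet> (xt (t - 1) - xt t))))"

(* The sequences LA and Lf are the local estimates. The step size minima are taken in ereal,
   where a/0 = \<infinity> for a > 0: a vanishing local estimate imposes no restriction. On real, a/0 = 0
   would force a zero step size. The parameter values at index 0 are not used. *)
definition ac_stepsizes ::
  "real \<Rightarrow> real \<Rightarrow> real \<Rightarrow> (nat \<Rightarrow> real) \<Rightarrow> (nat \<Rightarrow> real) \<Rightarrow>
   (nat \<Rightarrow> real) \<Rightarrow> (nat \<Rightarrow> real) \<Rightarrow> (nat \<Rightarrow> real) \<Rightarrow> (nat \<Rightarrow> real) \<Rightarrow> bool" where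
  "ac_stepsizes \<mu> \<alpha> b LA Lf \<beta> \<eta> \<tau> tt \<longleftrightarrow>
     \<eta> 1 > 0 \<and>
     \<beta> 1 = 0 \<and> (\<forall>t\<ge>2. \<beta> t = b) \<and>
     \<tau> 1 = 0 \<and> \<tau> 2 = \<mu> \<and> tt 1 = 0 \<and> tt 2 = 1 \<and>
     ereal (\<eta> 2) =
       min (ereal ((1 - b) * \<eta> 1)) (1 / ereal (4 * (LA 1)\<^sup>2 / \<mu> + 4 * Lf 1)) \<and>
     (\<forall>t\<ge>3.
        ereal (\<eta> t) =
          min (ereal (4 / 3 * \<eta> (t - 1)))
            (min (ereal ((\<tau> (t - 2) + \<mu>) / \<tau> (t - 1) * \<eta> (t - 1)))
                 (ereal (\<tau> (t - 1)) / ereal (4 * \<mu> * Lf (t - 1) + 4 * (LA (t - 1))\<^sup>2))) \<and>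
        \<tau> t = \<tau> (t - 1) + \<mu> / 2 *
          (\<alpha> + (1 - \<alpha>) * \<eta> t * ((4 * \<mu> * Lf (t - 1) + 4 * (LA (t - 1))\<^sup>2) / \<tau> (t - 1))) \<and>
        tt t = \<tau> t / \<mu>)"

definition L_hat :: "real \<Rightarrow> real \<Rightarrow> real \<Rightarrow> (nat \<Rightarrow> real) \<Rightarrow> (nat \<Rightarrow> real) \<Rightarrow> nat \<Rightarrow> real" where
  "L_hat \<mu> b \<eta>1 LA Lf t =
     Max (insert (1 / (4 * (1 - b) * \<eta>1)) ((\<lambda>s. (LA s)\<^sup>2 / \<mu> + Lf s) ` {1..t}))"

definition ergodic_avg :: "(nat \<Rightarrow> real) \<Rightarrow> (nat \<Rightarrow> 'a::real_vector) \<Rightarrow> nat \<Rightarrow> 'a" where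
  "ergodic_avg \<eta> u k = (1 / (\<Sum>t=1..k. \<eta> (t + 1))) *\<^sub>R (\<Sum>t=1..k. \<eta> (t + 1) *\<^sub>R u t)"

definition y_tilde ::
  "real \<Rightarrow> (nat \<Rightarrow> real) \<Rightarrow> (nat \<Rightarrow> real) \<Rightarrow> (nat \<Rightarrow> 'a::real_vector) \<Rightarrow> nat \<Rightarrow> 'a" where
  "y_tilde \<mu> \<eta> \<tau> y k =
     (1 / (\<mu> * (\<Sum>t=1..k. \<eta> (t + 1)))) *\<^sub>R
       ((\<Sum>t=1..k-1. (\<eta> (t + 1) * (\<mu> + \<tau> t) - \<eta> (t + 2) * \<tau> (t + 1)) *\<^sub>R y t)
        + (\<eta> (k + 1) * (\<mu> + \<tau> k)) *\<^sub>R y k)"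

end

theory Submission
  imports Defs
begin

text \<open>
  Write \<open>G t = A\<^sup>T (y t) + \<nabla>f (xt t)\<close>. Fix a comparison point \<open>(u, v)\<close> and add the optimality
  inequality of the dual step \<open>t\<close>, scaled by \<open>\<eta> (t + 1)\<close>, to that of the primal step \<open>t + 1\<close>. The
  primal step uses exactly \<open>G t\<close>, so the bilinear terms combine into those of the gap at
  \<open>(x t, y t)\<close>, and the only term left without a sign is \<open>\<eta> (t + 1) * (G t \<bullet> (x (t + 1) - x t))\<close>.
  Optimality of the primal step \<open>t\<close>, tested at \<open>x (t + 1)\<close>, replaces \<open>G t\<close> by \<open>G t - G (t - 1)\<close>;
  the price is an inner product of \<open>x t - xb t\<close> with \<open>x (t + 1) - x t\<close>.

  The moving average \<open>xb\<close> pays that price. Measuring progress at \<open>xb\<close> instead of \<open>x\<close> leaves the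
  surplus \<open>(1 - b / 2) * |x (t + 1) - xb t|\<^sup>2\<close> in every step. The part with coefficient \<open>1 / 2\<close> and
  the remainder handed on by the preceding step (\<open>potential\<close>) absorb the inner product as soon as
  \<open>\<eta> (t + 1) \<le> 2 * (1 - b)\<^sup>2 * \<eta> t\<close>, and \<open>|x (t + 1) - x t|\<^sup>2 / 4\<close> is
  still left over (\<open>extrapolation_quadratic_bound\<close>). The growth factor \<open>4 / 3\<close> of the step sizes
  is, for \<open>b < 1\<close>, at most \<open>2 * (1 - b)\<^sup>2\<close> exactly when \<open>b \<le> 1 - sqrt 6 / 3\<close>.

  Young's inequality splits the product with \<open>G t - G (t - 1)\<close> into this quarter, the proximal term of the
  dual step, and the Bregman gap of \<open>f\<close> (\<open>young_curvature_bound\<close>). The local estimates of the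
  norm of \<open>A\<close> and of the smoothness constant suffice for this, because only the actual differences
  of consecutive iterates occur. The first step has no predecessor to borrow from; there
  \<open>\<tau> 1 = 0\<close> bounds the dual increment by the primal one, which produces the extra term in
  \<open>|x 1 - x 0|\<^sup>2\<close> (\<open>primal_first_step\<close>).

  Since \<open>tt = \<tau> / \<mu>\<close>, the dual distances and the values of \<open>f\<close> at the extrapolated points \<open>xt\<close> carry
  the same coefficients. Summation by parts turns them into weights that are nonnegative by the
  second bound in the step size rule. The weighted mean of the \<open>y t\<close> is the point of \<open>y_tilde\<close>, and
  the weighted mean of the \<open>xt t\<close> is the ergodic average of the \<open>x t\<close>, so Jensen's inequality yields
  the gap bound with the factor \<open>1 / (2 * (\<Sum>t=1..k. \<eta> (t + 1)))\<close> (\<open>ergodic_gap_bound\<close>).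

  The lower bound on the step sizes is an induction: from \<open>t = 3\<close> on, \<open>\<tau>\<close> grows in every step by at least
  \<open>\<alpha> * \<mu> / 2\<close> and at most \<open>\<mu> / 2\<close>, so each of the three terms in the minimum lets \<open>\<eta>\<close> grow fast
  enough. Summing it gives the rate.
\<close>

section \<open>Step sizes\<close>

text \<open>
  A vanishing denominator makes the quotient infinite, so the step size is then the other entry of
  the minimum. The product form \<open>e * d \<le> n\<close> covers both cases.
\<close>
lemma ereal_min_quotient:
  fixes e a n d :: real
  assumes e: "ereal e = min (ereal a) (ereal n / ereal d)" and n: "n > 0" and d: "d \<ge> 0"
  shows "e \<le> a" "e * d \<le> n" "e = a \<or> d > 0 \<and> e = n / d"
proof -
  have "e \<le> a \<and> e * d \<le> n \<and> (e = a \<or> d > 0 \<and> e = n / d)"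
  proof (cases "d = 0")
    case True
    then have "ereal n / ereal d = \<infinity>"
      using n by (simp add: divide_ereal_def)
    with e True n show ?thesis by simp
  next
    case False
    with d have "d > 0" by simp
    with e have "e = min a (n / d)" by (simp add: min_def split: if_splits)
    with \<open>d > 0\<close> show ?thesis by (auto simp: min_def field_simps)
  qed
  then show "e \<le> a" "e * d \<le> n" "e = a \<or> d > 0 \<and> e = n / d" by auto
qed

locale ac_stepsize_rule =
  fixes \<mu> \<alpha> b :: real and LA LF \<beta> \<eta> \<tau> tt :: "nat \<Rightarrow> real"
  assumes mu_pos: "0 < \<mu>" and alpha_pos: "0 < \<alpha>" and alpha_le: "\<alpha> \<le> 1"
    and b_pos: "0 < b" and b_le: "b \<le> 1 - sqrt 6 / 3"
    and stepsizes: "ac_stepsizes \<mu> \<alpha> b LA LF \<beta> \<eta> \<tau> tt"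
begin

text \<open>
  The local curvature that limits the steps. Maximising the coupling over \<open>y\<close> with a \<open>\<mu>\<close>-strongly
  convex penalty gives a function of \<open>x\<close> with smoothness constant \<open>|A|\<^sup>2 / \<mu>\<close>, which \<open>(LA t)\<^sup>2 / \<mu>\<close>
  estimates locally.
\<close>
definition curv :: "nat \<Rightarrow> real" where
  "curv t = (LA t)\<^sup>2 / \<mu> + LF t"

lemma four_mu_curv: "4 * \<mu> * LF t + 4 * (LA t)\<^sup>2 = 4 * \<mu> * curv t"
  using mu_pos by (simp add: curv_def field_simps)

lemma curv_nonneg: "0 \<le> LF t \<Longrightarrow> 0 \<le> curv t"
  using mu_pos by (simp add: curv_def)

lemma b_less_1: "b < 1"
  using b_le real_sqrt_gt_zero[of 6] by linarith

lemma one_minus_b_square: "2 / 3 \<le> (1 - b)\<^sup>2"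
proof -
  have "(sqrt 6 / 3)\<^sup>2 \<le> (1 - b)\<^sup>2"
    using b_le by (intro power_mono) auto
  then show ?thesis by (simp add: power_divide)
qed

lemma eta1_pos: "0 < \<eta> 1" and beta_1: "\<beta> 1 = 0" and beta_eq: "2 \<le> t \<Longrightarrow> \<beta> t = b"
  and tau_1: "\<tau> 1 = 0" and tau_2: "\<tau> 2 = \<mu>"
  using stepsizes unfolding ac_stepsizes_def by blast+

lemma tt_eq: "1 \<le> t \<Longrightarrow> tt t = \<tau> t / \<mu>"
proof -
  assume "1 \<le> t"
  then consider "t = 1" | "t = 2" | "3 \<le> t" by linarith
  then show ?thesis
  proof cases
    case 3
    then show ?thesis using stepsizes unfolding ac_stepsizes_def by blast
  next
    case 1
    moreover have "tt 1 = 0" using stepsizes unfolding ac_stepsizes_def by blast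
    ultimately show ?thesis using tau_1 by simp
  next
    case 2
    moreover have "tt 2 = 1" using stepsizes unfolding ac_stepsizes_def by blast
    ultimately show ?thesis using tau_2 mu_pos by simp
  qed
qed

lemma eta_2:
  assumes "0 \<le> LF 1"
  shows "0 < \<eta> 2" "\<eta> 2 \<le> (1 - b) * \<eta> 1" "\<eta> 2 * curv 1 \<le> 1 / 4"
    "\<eta> 2 = (1 - b) * \<eta> 1 \<or> 0 < curv 1 \<and> \<eta> 2 = 1 / (4 * curv 1)"
proof -
  have "4 * (LA 1)\<^sup>2 / \<mu> + 4 * LF 1 = 4 * curv 1" by (simp add: curv_def)
  moreover have "ereal (\<eta> 2) =
      min (ereal ((1 - b) * \<eta> 1)) (1 / ereal (4 * (LA 1)\<^sup>2 / \<mu> + 4 * LF 1))"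
    using stepsizes unfolding ac_stepsizes_def by blast
  ultimately have "ereal (\<eta> 2) = min (ereal ((1 - b) * \<eta> 1)) (ereal 1 / ereal (4 * curv 1))"
    by (simp only: one_ereal_def)
  note * = ereal_min_quotient[OF this] curv_nonneg[OF assms]
  show "\<eta> 2 \<le> (1 - b) * \<eta> 1" "\<eta> 2 * curv 1 \<le> 1 / 4"
    "\<eta> 2 = (1 - b) * \<eta> 1 \<or> 0 < curv 1 \<and> \<eta> 2 = 1 / (4 * curv 1)"
    using * by auto
  then show "0 < \<eta> 2" using eta1_pos b_less_1 by auto
qed

lemma eta_step:
  assumes t: "3 \<le> t" and tau: "0 < \<tau> (t - 1)" and LF: "0 \<le> LF (t - 1)"
  shows "\<eta> t \<le> 4 / 3 * \<eta> (t - 1)"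
    "\<tau> (t - 1) * \<eta> t \<le> (\<tau> (t - 2) + \<mu>) * \<eta> (t - 1)"
    "4 * \<mu> * curv (t - 1) * \<eta> t \<le> \<tau> (t - 1)"
    "\<eta> t = 4 / 3 * \<eta> (t - 1) \<or> \<eta> t = (\<tau> (t - 2) + \<mu>) / \<tau> (t - 1) * \<eta> (t - 1) \<or>
     0 < curv (t - 1) \<and> \<eta> t = \<tau> (t - 1) / (4 * \<mu> * curv (t - 1))"
    "\<tau> t = \<tau> (t - 1) + \<mu> / 2 * (\<alpha> + (1 - \<alpha>) * (4 * \<mu> * curv (t - 1) * \<eta> t / \<tau> (t - 1)))"
proof -
  let ?r = "(\<tau> (t - 2) + \<mu>) / \<tau> (t - 1) * \<eta> (t - 1)"
  have "ereal (\<eta> t) = min (ereal (4 / 3 * \<eta> (t - 1)))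
            (min (ereal ?r) (ereal (\<tau> (t - 1)) / ereal (4 * \<mu> * curv (t - 1))))"
    and tau_eq: "\<tau> t = \<tau> (t - 1) + \<mu> / 2 *
          (\<alpha> + (1 - \<alpha>) * \<eta> t * ((4 * \<mu> * curv (t - 1)) / \<tau> (t - 1)))"
    using stepsizes t unfolding ac_stepsizes_def four_mu_curv by blast+
  then have "ereal (\<eta> t) = min (ereal (min (4 / 3 * \<eta> (t - 1)) ?r))
            (ereal (\<tau> (t - 1)) / ereal (4 * \<mu> * curv (t - 1)))"
    by (simp only: ereal_min min.assoc)
  note * = ereal_min_quotient[OF this tau]
  have c: "0 \<le> 4 * \<mu> * curv (t - 1)" using curv_nonneg[OF LF] mu_pos by simp
  show "\<eta> t \<le> 4 / 3 * \<eta> (t - 1)" "4 * \<mu> * curv (t - 1) * \<eta> t \<le> \<tau> (t - 1)"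
    using *(1,2)[OF c] by (auto simp: mult.commute)
  have "\<eta> t \<le> ?r" using *(1)[OF c] by simp
  then show "\<tau> (t - 1) * \<eta> t \<le> (\<tau> (t - 2) + \<mu>) * \<eta> (t - 1)"
    using tau by (simp add: field_simps)
  show "\<eta> t = 4 / 3 * \<eta> (t - 1) \<or> \<eta> t = ?r \<or>
     0 < curv (t - 1) \<and> \<eta> t = \<tau> (t - 1) / (4 * \<mu> * curv (t - 1))"
    using *(3)[OF c] mu_pos by (auto simp: min_def zero_less_mult_iff split: if_splits)
  show "\<tau> t = \<tau> (t - 1) + \<mu> / 2 * (\<alpha> + (1 - \<alpha>) * (4 * \<mu> * curv (t - 1) * \<eta> t / \<tau> (t - 1)))"
    using tau_eq by (simp add: mult_ac)
qed

text \<open>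
  The bracket in the update of \<open>\<tau>\<close> is a convex combination of \<open>1\<close> and a ratio that the step size
  rule keeps in \<open>[0, 1]\<close>.
\<close>
lemma tau_increment:
  assumes t: "3 \<le> t" and tau: "0 < \<tau> (t - 1)" and LF: "0 \<le> LF (t - 1)" and eta: "0 \<le> \<eta> t"
  shows "\<tau> (t - 1) + \<mu> * \<alpha> / 2 \<le> \<tau> t" "\<tau> t \<le> \<tau> (t - 1) + \<mu> / 2"
proof -
  define r where "r = 4 * \<mu> * curv (t - 1) * \<eta> t / \<tau> (t - 1)"
  have r: "0 \<le> r" "r \<le> 1"
    using eta_step(3)[OF t tau LF] tau curv_nonneg[OF LF] mu_pos eta by (auto simp: r_def)
  have eq: "\<tau> t = \<tau> (t - 1) + \<mu> / 2 * (\<alpha> + (1 - \<alpha>) * r)"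
    unfolding r_def by (rule eta_step(5)[OF t tau LF])
  have "0 \<le> (1 - \<alpha>) * r" "(1 - \<alpha>) * r \<le> (1 - \<alpha>) * 1"
    using r alpha_le mult_left_mono[of r 1 "1 - \<alpha>"] by auto
  then have "\<mu> / 2 * \<alpha> \<le> \<mu> / 2 * (\<alpha> + (1 - \<alpha>) * r)" "\<mu> / 2 * (\<alpha> + (1 - \<alpha>) * r) \<le> \<mu> / 2 * 1"
    using mu_pos by (intro mult_left_mono; simp)+
  with eq show "\<tau> (t - 1) + \<mu> * \<alpha> / 2 \<le> \<tau> t" "\<tau> t \<le> \<tau> (t - 1) + \<mu> / 2" by auto
qed

text \<open>
  Nonnegativity of \<open>LF\<close> is required only before \<open>t\<close>: for the iteration itself it holds because
  the points \<open>xt\<close> lie in the domain of \<open>f\<close>, which in turn rests on these bounds.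
\<close>
lemma stepsize_bounds:
  assumes "2 \<le> t" and "\<And>s. 1 \<le> s \<Longrightarrow> s < t \<Longrightarrow> 0 \<le> LF s"
  shows "0 < \<eta> t \<and> 0 \<le> \<tau> (t - 1) \<and> \<mu> * (1 + \<alpha> * (real t - 2) / 2) \<le> \<tau> t \<and> \<tau> t \<le> \<mu> * real t / 2"
  using assms
proof (induction t rule: nat_induct_at_least)
  case base
  then show ?case using eta_2(1) tau_1 tau_2 by simp
next
  case (Suc n)
  have IH: "0 < \<eta> n" "0 \<le> \<tau> (n - 1)" "\<mu> * (1 + \<alpha> * (real n - 2) / 2) \<le> \<tau> n" "\<tau> n \<le> \<mu> * real n / 2"
    using Suc.IH Suc.prems by auto
  have "0 \<le> \<alpha> * (real n - 2) / 2" using Suc.hyps alpha_pos by simp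
  then have "\<mu> * 1 \<le> \<mu> * (1 + \<alpha> * (real n - 2) / 2)" using mu_pos by (intro mult_left_mono) auto
  then have tau: "0 < \<tau> n" using IH mu_pos by linarith
  have LF: "0 \<le> LF n" using Suc.prems Suc.hyps by auto
  have n: "3 \<le> Suc n" using Suc.hyps by simp
  note step = eta_step[of "Suc n", OF n] and inc = tau_increment[of "Suc n", OF n]
  have eta: "0 < \<eta> (Suc n)"
    using step(4) tau LF IH mu_pos by (auto simp: numeral_2_eq_2)
  have "\<tau> n + \<mu> * \<alpha> / 2 \<le> \<tau> (Suc n)" "\<tau> (Suc n) \<le> \<tau> n + \<mu> / 2"
    using inc tau LF eta by auto
  with IH eta tau show ?case by (auto simp: algebra_simps add_divide_distrib diff_divide_distrib)
qed

end

locale ac_stepsize_nonneg = ac_stepsize_rule +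
  assumes LF_nonneg: "1 \<le> t \<Longrightarrow> 0 \<le> LF t"
begin

lemma eta_pos: "1 \<le> t \<Longrightarrow> 0 < \<eta> t"
  using stepsize_bounds[of t] LF_nonneg eta1_pos by (cases "t = 1") auto

lemma tau_lower: "2 \<le> t \<Longrightarrow> \<mu> * (1 + \<alpha> * (real t - 2) / 2) \<le> \<tau> t"
  and tau_upper: "2 \<le> t \<Longrightarrow> \<tau> t \<le> \<mu> * real t / 2"
  using stepsize_bounds[of t] LF_nonneg by auto

lemma tau_pos: "2 \<le> t \<Longrightarrow> 0 < \<tau> t"
proof -
  assume t: "2 \<le> t"
  then have "0 \<le> \<alpha> * (real t - 2) / 2" using alpha_pos by simp
  then have "0 < \<mu> * (1 + \<alpha> * (real t - 2) / 2)" using mu_pos by (intro mult_pos_pos) linarith+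
  with tau_lower[OF t] show ?thesis by linarith
qed

lemma tau_nonneg: "1 \<le> t \<Longrightarrow> 0 \<le> \<tau> t"
  using tau_pos[of t] tau_1 by (cases "t = 1") auto

lemma eta_tau_decrease: "1 \<le> t \<Longrightarrow> \<eta> (t + 2) * \<tau> (t + 1) \<le> \<eta> (t + 1) * (\<mu> + \<tau> t)"
  using eta_step(2)[of "t + 2"] tau_pos[of "t + 1"] LF_nonneg[of "t + 1"]
  by (simp add: mult_ac add_ac)

lemma eta_curv_le: "2 \<le> t \<Longrightarrow> \<eta> (t + 1) * (4 * \<mu> * curv t) \<le> \<tau> t"
  using eta_step(3)[of "t + 1"] tau_pos[of t] LF_nonneg[of t] by (simp add: mult_ac)

lemma eta_ratio_le: "2 \<le> t \<Longrightarrow> \<eta> (t + 1) \<le> 2 * (1 - b)\<^sup>2 * \<eta> t"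
proof -
  assume t: "2 \<le> t"
  have "\<eta> (t + 1) \<le> 4 / 3 * \<eta> t"
    using eta_step(1)[of "t + 1"] tau_pos[of t] LF_nonneg[of t] t by simp
  also have "4 / 3 * \<eta> t \<le> 2 * (1 - b)\<^sup>2 * \<eta> t"
    using one_minus_b_square eta_pos[of t] t by (intro mult_right_mono) auto
  finally show ?thesis .
qed

abbreviation Lhat :: "nat \<Rightarrow> real" where
  "Lhat \<equiv> L_hat \<mu> b (\<eta> 1) LA LF"

lemma curv_le_Lhat: "1 \<le> s \<Longrightarrow> s \<le> t \<Longrightarrow> curv s \<le> Lhat t"
  unfolding L_hat_def curv_def by (intro Max_ge) auto

lemma Lhat_ge_init: "1 / (4 * (1 - b) * \<eta> 1) \<le> Lhat t"
  unfolding L_hat_def by (intro Max_ge) auto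

lemma Lhat_pos: "0 < Lhat t"
proof -
  have "0 < 1 / (4 * (1 - b) * \<eta> 1)" using eta1_pos b_less_1 by simp
  with Lhat_ge_init[of t] show ?thesis by linarith
qed

lemma Lhat_mono: "s \<le> t \<Longrightarrow> Lhat s \<le> Lhat t"
  unfolding L_hat_def by (intro Max_mono) auto

text \<open>
  The second step size attains the bound \<open>1 / (4 * Lhat 1)\<close>, which is better than the general
  estimate; the estimate for the third step size needs this.
\<close>
lemma eta_2_Lhat:
  assumes "1 \<le> t"
  shows "1 \<le> 4 * \<eta> 2 * Lhat t"
  using eta_2(4)[OF LF_nonneg[of 1]]
proof
  assume eta: "\<eta> 2 = (1 - b) * \<eta> 1"
  then have "0 < \<eta> 2" using eta1_pos b_less_1 by simp
  moreover have "1 / (4 * \<eta> 2) \<le> Lhat t"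
    using Lhat_ge_init[of t] unfolding eta by (simp only: mult.assoc)
  ultimately show ?thesis by (simp add: pos_divide_le_eq mult_ac)
next
  assume "0 < curv 1 \<and> \<eta> 2 = 1 / (4 * curv 1)"
  then show ?thesis
    using curv_le_Lhat[of 1 t] assms by (simp add: field_simps)
qed simp

text \<open>
  Each entry of the minimum that may define \<open>\<eta> (Suc n)\<close> is treated separately. The factor \<open>4 / 3\<close>
  covers the required growth. The factor \<open>(\<tau> (n - 1) + \<mu>) / \<tau> n\<close> is at least \<open>1 + 1 / n\<close> for
  \<open>n \<ge> 3\<close>, which matches a linearly growing bound. The third entry is explicit, and \<open>\<tau>\<close> itself
  grows linearly. For \<open>n = 2\<close> the second factor is \<open>1\<close>, and \<open>eta_2_Lhat\<close> makes up for it.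
\<close>
lemma eta_lower_bound:
  assumes "2 \<le> t"
  shows "(3 + \<alpha> * (real t - 3)) / (12 * Lhat (t - 1)) \<le> \<eta> t"
proof -
  have "3 + \<alpha> * (real t - 3) \<le> 12 * \<eta> t * Lhat (t - 1)"
    using assms
  proof (induction t rule: nat_induct_at_least)
    case base
    have "1 \<le> 4 * \<eta> 2 * Lhat 1" by (rule eta_2_Lhat) simp
    then show ?case using alpha_pos by simp
  next
    case (Suc n)
    let ?m = "3 + \<alpha> * (real n - 3)"
    have LF: "0 \<le> LF n" and tau: "0 < \<tau> n" and eta: "0 < \<eta> n"
      using LF_nonneg tau_pos eta_pos Suc.hyps by auto
    have L: "Lhat (n - 1) \<le> Lhat n" "curv n \<le> Lhat n" "0 < Lhat n"
      using Lhat_mono[of "n - 1" n] curv_le_Lhat[of n n] Lhat_pos Suc.hyps by auto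
    have "12 * \<eta> n * Lhat (n - 1) \<le> 12 * \<eta> n * Lhat n"
      using L eta by (intro mult_left_mono) auto
    with Suc.IH have IH: "?m \<le> 12 * \<eta> n * Lhat n" by linarith
    have cases: "\<eta> (Suc n) = 4 / 3 * \<eta> n \<or> \<eta> (Suc n) = (\<tau> (n - 1) + \<mu>) / \<tau> n * \<eta> n \<or>
        0 < curv n \<and> \<eta> (Suc n) = \<tau> n / (4 * \<mu> * curv n)"
      using eta_step(4)[of "Suc n"] tau LF Suc.hyps by (auto simp: numeral_2_eq_2)
    have "?m + \<alpha> \<le> 12 * \<eta> (Suc n) * Lhat n"
    proof (cases "n = 2")
      case n: True
      from cases consider "\<eta> n \<le> \<eta> (Suc n)" | "0 < curv n" "\<eta> (Suc n) = 1 / (4 * curv n)"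
        using tau_1 tau_2 mu_pos eta n by auto
      then show ?thesis
      proof cases
        case 1
        have "3 \<le> 12 * \<eta> 2 * Lhat 2" using eta_2_Lhat[of 2] by simp
        moreover have "\<eta> 2 * Lhat 2 \<le> \<eta> (Suc n) * Lhat 2"
          using 1 n L by (intro mult_right_mono) auto
        ultimately show ?thesis using n by simp
      next
        case 2
        then have "3 = 12 * \<eta> (Suc n) * curv n" by simp
        also have "\<dots> \<le> 12 * \<eta> (Suc n) * Lhat n"
          using L eta_pos[of "Suc n"] by (intro mult_left_mono) auto
        finally show ?thesis using n by simp
      qed
    next
      case False
      with Suc.hyps have n: "3 \<le> n" by simp
      have an: "0 \<le> \<alpha> * (real n - 3)" using n alpha_pos by simp
      from cases consider "\<eta> (Suc n) = 4 / 3 * \<eta> n" | "\<eta> (Suc n) = (\<tau> (n - 1) + \<mu>) / \<tau> n * \<eta> n"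
        | "0 < curv n" "\<eta> (Suc n) = \<tau> n / (4 * \<mu> * curv n)" by auto
      then show ?thesis
      proof cases
        case 1
        have "?m + \<alpha> \<le> 4 / 3 * ?m" using an alpha_le by simp
        also have "\<dots> \<le> 4 / 3 * (12 * \<eta> n * Lhat n)" using IH by (intro mult_left_mono) auto
        also have "\<dots> = 12 * \<eta> (Suc n) * Lhat n" using 1 by simp
        finally show ?thesis .
      next
        case 2
        have LF': "0 \<le> LF (n - 1)" "0 < \<tau> (n - 1)"
          using LF_nonneg[of "n - 1"] tau_pos[of "n - 1"] n by auto
        (* The growth of tau by at most mu/2 leaves a factor of at least 1 + 1/n. *)
        have "\<tau> n + \<mu> / 2 \<le> \<tau> (n - 1) + \<mu>"
          using tau_increment(2)[of n] LF' eta n by simp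
        moreover have "\<tau> n * (1 / real n) \<le> \<mu> / 2"
          using tau_upper[of n] n by (simp add: field_simps)
        ultimately have "\<tau> n * (1 + 1 / real n) \<le> \<tau> (n - 1) + \<mu>"
          unfolding distrib_left mult_1_right by linarith
        then have ratio: "1 + 1 / real n \<le> (\<tau> (n - 1) + \<mu>) / \<tau> n"
          using tau by (simp add: pos_le_divide_eq mult.commute)
        have "\<alpha> * real n \<le> ?m" using alpha_le by (simp add: algebra_simps)
        then have "?m + \<alpha> \<le> (1 + 1 / real n) * ?m"
          using n by (simp add: field_simps)
        also have "\<dots> \<le> (1 + 1 / real n) * (12 * \<eta> n * Lhat n)"
          using IH by (intro mult_left_mono) auto
        also have "\<dots> \<le> (\<tau> (n - 1) + \<mu>) / \<tau> n * (12 * \<eta> n * Lhat n)"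
          using ratio eta L by (intro mult_right_mono) auto
        finally show ?thesis unfolding 2 by (simp only: mult_ac)
      next
        case 3
        have "\<mu> * (1 + \<alpha> * (real n - 2) / 2) \<le> \<tau> n" using tau_lower n by simp
        then have "(1 + \<alpha> * (real n - 2) / 2) \<le> \<tau> n / \<mu>"
          using mu_pos by (simp add: field_simps)
        then have "?m + \<alpha> \<le> 3 * (\<tau> n / \<mu>)"
          using an by (simp add: algebra_simps add_divide_distrib) (use an alpha_pos in argo)
        also have "\<dots> = 12 * \<eta> (Suc n) * curv n" using 3 mu_pos by simp
        also have "\<dots> \<le> 12 * \<eta> (Suc n) * Lhat n"
          using L eta_pos[of "Suc n"] by (intro mult_left_mono) auto
        finally show ?thesis .
      qed
    qed
    then show ?case by (simp add: algebra_simps)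
  qed
  then show ?thesis
    using Lhat_pos[of "t - 1"] by (simp add: divide_le_eq mult_ac)
qed

lemma eta_sum_lower_bound:
  assumes "2 \<le> k"
  shows "(6 * real k + \<alpha> * real k * (real k - 3)) / (12 * Lhat k) \<le> 2 * (\<Sum>t=1..k. \<eta> (t + 1))"
proof -
  have "(\<Sum>t=1..n. 3 + \<alpha> * (real t - 2)) = 3 * real n + \<alpha> * real n * (real n - 3) / 2" for n
    by (induction n) (auto simp: algebra_simps add_divide_distrib diff_divide_distrib)
  then have "(6 * real k + \<alpha> * real k * (real k - 3)) / (12 * Lhat k)
      = 2 * (\<Sum>t=1..k. (3 + \<alpha> * (real t - 2)) / (12 * Lhat k))"
    by (simp add: sum_divide_distrib[symmetric])
  also have "\<dots> \<le> 2 * (\<Sum>t=1..k. \<eta> (t + 1))"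
  proof (intro mult_left_mono sum_mono)
    fix t assume t: "t \<in> {1..k}"
    have "0 \<le> \<alpha> * (real t - 1)" using t alpha_pos by simp
    then have "0 \<le> 3 + \<alpha> * (real t - 2)" using alpha_le by (simp add: algebra_simps)
    then have "(3 + \<alpha> * (real t - 2)) / (12 * Lhat k) \<le> (3 + \<alpha> * (real t - 2)) / (12 * Lhat t)"
      using Lhat_mono[of t k] Lhat_pos t by (intro divide_left_mono) auto
    also have "\<dots> \<le> \<eta> (t + 1)" using eta_lower_bound[of "t + 1"] t by (simp add: algebra_simps)
    finally show "(3 + \<alpha> * (real t - 2)) / (12 * Lhat k) \<le> \<eta> (t + 1)" .
  qed simp
  finally show ?thesis .
qed

end

section \<open>Convexity and elementary inequalities\<close>

lemma norm_square_convex_combination: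
  fixes p q :: "'a::real_inner"
  shows "(norm ((1 - s) *\<^sub>R p + s *\<^sub>R q))\<^sup>2 =
    (1 - s) * (norm p)\<^sup>2 + s * (norm q)\<^sup>2 - s * (1 - s) * (norm (p - q))\<^sup>2"
  by (simp add: power2_norm_eq_inner inner_add_left inner_add_right inner_diff_left
      inner_diff_right inner_commute algebra_simps)

lemma convex_on_norm_square:
  fixes c :: "'a::real_inner"
  shows "convex_on UNIV (\<lambda>z. (norm (c - z))\<^sup>2)"
proof (intro convex_onI)
  fix t :: real and p q :: 'a
  assume "0 < t" "t < 1"
  moreover have "c - ((1 - t) *\<^sub>R p + t *\<^sub>R q) = (1 - t) *\<^sub>R (c - p) + t *\<^sub>R (c - q)"
    by (simp add: algebra_simps)
  ultimately show "(norm (c - ((1 - t) *\<^sub>R p + t *\<^sub>R q)))\<^sup>2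
      \<le> (1 - t) * (norm (c - p))\<^sup>2 + t * (norm (c - q))\<^sup>2"
    by (simp add: norm_square_convex_combination)
qed simp

text \<open>
  On segments of \<open>C\<close> the quadratic terms curve with modulus exactly \<open>c + d\<close>. Comparing the minimiser with the points of
  the segment towards \<open>v\<close> and letting them approach the minimiser yields the quadratic gain.
\<close>
lemma prox_three_point:
  fixes p q z v :: "'a::real_inner"
  assumes C: "convex C" and \<phi>: "convex_on C \<phi>"
    and z: "is_arg_min (\<lambda>w. \<phi> w + c / 2 * (norm (p - w))\<^sup>2 + d / 2 * (norm (q - w))\<^sup>2) (\<lambda>w. w \<in> C) z"
    and v: "v \<in> C"
  shows "\<phi> z + c / 2 * (norm (p - z))\<^sup>2 + d / 2 * (norm (q - z))\<^sup>2 + (c + d) / 2 * (norm (z - v))\<^sup>2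
    \<le> \<phi> v + c / 2 * (norm (p - v))\<^sup>2 + d / 2 * (norm (q - v))\<^sup>2"
proof -
  define F where "F w = \<phi> w + c / 2 * (norm (p - w))\<^sup>2 + d / 2 * (norm (q - w))\<^sup>2" for w
  define K where "K = (c + d) / 2 * (norm (z - v))\<^sup>2"
  have zC: "z \<in> C" and zmin: "\<And>w. w \<in> C \<Longrightarrow> F z \<le> F w"
    using z by (auto simp: is_arg_min_linorder F_def)
  have "r * K \<le> F v - F z" if r: "0 < r" "r < 1" for r
  proof -
    define s where "s = 1 - r"
    have s: "0 < s" "s < 1" using r by (auto simp: s_def)
    let ?w = "(1 - s) *\<^sub>R z + s *\<^sub>R v"
    have split: "(norm (c' - ?w))\<^sup>2 = (1 - s) * (norm (c' - z))\<^sup>2 + s * (norm (c' - v))\<^sup>2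
        - s * (1 - s) * (norm (z - v))\<^sup>2" for c'
    proof -
      have "c' - ?w = (1 - s) *\<^sub>R (c' - z) + s *\<^sub>R (c' - v)" by (simp add: algebra_simps)
      moreover have "c' - z - (c' - v) = - (z - v)" by simp
      ultimately show ?thesis by (simp only: norm_square_convex_combination norm_minus_cancel)
    qed
    have "?w \<in> C" using C zC v s by (simp add: convex_alt)
    then have "F z \<le> F ?w" by (rule zmin)
    also have "\<dots> \<le> (1 - s) * F z + s * F v - s * (1 - s) * K"
    proof -
      have "\<phi> ?w \<le> (1 - s) * \<phi> z + s * \<phi> v"
        using convex_onD[OF \<phi>, of s z v] s zC v by simp
      then show ?thesis unfolding F_def split K_def by (simp add: field_simps)
    qed
    finally have "s * (r * K) \<le> s * (F v - F z)" by (simp add: s_def algebra_simps)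
    then show ?thesis using s by simp
  qed
  then have "K \<le> F v - F z" by (rule field_le_mult_one_interval)
  then show ?thesis by (simp add: F_def K_def)
qed

lemma weighted_jensen:
  fixes z :: "nat \<Rightarrow> 'a::real_vector"
  assumes \<phi>: "convex_on C \<phi>" and fin: "finite I" and w: "\<And>i. i \<in> I \<Longrightarrow> 0 \<le> w i"
    and W: "sum w I = W" "0 < W" and z: "\<And>i. i \<in> I \<Longrightarrow> z i \<in> C"
  shows "(1 / W) *\<^sub>R (\<Sum>i\<in>I. w i *\<^sub>R z i) \<in> C"
    "W * \<phi> ((1 / W) *\<^sub>R (\<Sum>i\<in>I. w i *\<^sub>R z i)) \<le> (\<Sum>i\<in>I. w i * \<phi> (z i))"
proof -
  have eq: "(1 / W) *\<^sub>R (\<Sum>i\<in>I. w i *\<^sub>R z i) = (\<Sum>i\<in>I. (w i / W) *\<^sub>R z i)"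
    by (simp add: scaleR_sum_right)
  have 1: "(\<Sum>i\<in>I. w i / W) = 1" using W by (simp add: sum_divide_distrib[symmetric])
  have nn: "0 \<le> w i / W" if "i \<in> I" for i using w[OF that] W by simp
  have ne: "I \<noteq> {}" using W by auto
  have C: "convex C" using \<phi> by (rule convex_on_imp_convex)
  show "(1 / W) *\<^sub>R (\<Sum>i\<in>I. w i *\<^sub>R z i) \<in> C"
    unfolding eq using fin C 1 nn z by (intro convex_sum) auto
  have "\<phi> (\<Sum>i\<in>I. (w i / W) *\<^sub>R z i) \<le> (\<Sum>i\<in>I. w i / W * \<phi> (z i))"
    using fin ne \<phi> 1 nn z by (intro convex_on_sum) auto
  then have "W * \<phi> (\<Sum>i\<in>I. (w i / W) *\<^sub>R z i) \<le> W * (\<Sum>i\<in>I. w i / W * \<phi> (z i))"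
    using W by (intro mult_left_mono) auto
  also have "\<dots> = (\<Sum>i\<in>I. w i * \<phi> (z i))" using W by (simp add: sum_distrib_left)
  finally show "W * \<phi> ((1 / W) *\<^sub>R (\<Sum>i\<in>I. w i *\<^sub>R z i)) \<le> (\<Sum>i\<in>I. w i * \<phi> (z i))"
    unfolding eq .
qed

text \<open>
  With \<open>p = x t - xb t\<close> and \<open>q = x (t + 1) - x t\<close>, the sum \<open>p + q\<close> is \<open>x (t + 1) - xb t\<close>. The inner
  product has an arbitrary coefficient \<open>s\<close> in \<open>[0, 1 - b]\<close>, because step sizes may drop sharply, so
  the term in \<open>p\<close> cannot come from the inner product itself and is taken from the preceding step.
  After expansion \<open>p \<bullet> q\<close> has the coefficient \<open>1 - 2 * s\<close>, of modulus at most \<open>1\<close>, and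
  \<open>(|p| - |q| / 2)\<^sup>2 \<ge> 0\<close> finishes.
\<close>
lemma extrapolation_quadratic_bound:
  fixes p q :: "'a::real_inner"
  assumes b: "0 < b" "b < 1" and s: "0 \<le> s" "s \<le> 1 - b"
  shows "(norm q)\<^sup>2 / 4 + 2 * s * (p \<bullet> q) \<le> (norm (p + q))\<^sup>2 / 2 + (norm p)\<^sup>2 / (2 * (1 - b))"
proof -
  define K where "K = (norm p)\<^sup>2 / (2 * (1 - b))"
  have borrowed: "(norm p)\<^sup>2 / 2 \<le> K"
    unfolding K_def using b by (intro divide_left_mono) auto
  have "- ((1 - 2 * s) * (p \<bullet> q)) \<le> \<bar>1 - 2 * s\<bar> * \<bar>p \<bullet> q\<bar>"
    by (metis abs_ge_minus_self abs_mult)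
  also have "\<dots> \<le> 1 * (norm p * norm q)"
    using s b Cauchy_Schwarz_ineq2[of p q] by (intro mult_mono) auto
  also have "\<dots> \<le> (norm p)\<^sup>2 + (norm q)\<^sup>2 / 4"
    using zero_le_power2[of "norm p - norm q / 2"] by (simp add: power2_diff power_divide)
  finally show ?thesis
    using borrowed unfolding K_def[symmetric]
    by (simp add: power2_norm_eq_inner inner_add_left inner_add_right inner_commute field_simps)
qed

text \<open>
  The substitute for the preceding bound in the first step, where nothing can be borrowed. Expanding
  \<open>2 * (p \<bullet> q) = |p + q|\<^sup>2 - |p|\<^sup>2 - |q|\<^sup>2\<close> makes the claim linear in \<open>s\<close>, so it is enough to
  complete a square at each of the two extreme values \<open>s = 0\<close> and \<open>s = 1 / 2\<close>.
\<close>
lemma first_step_quadratic_bound: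
  fixes p q :: "'a::real_inner"
  assumes s: "0 \<le> s" "2 * s \<le> 1" and h: "0 \<le> h" "h \<le> 1 / 4"
  shows "s * (norm p)\<^sup>2 + h * (norm p * norm q) + 2 * s * (p \<bullet> q)
    \<le> (norm (p + q))\<^sup>2 / 2 + 5 / 4 * h * (norm p)\<^sup>2"
proof -
  let ?P = "norm p" and ?Q = "norm q" and ?W = "norm (p + q)"
  have h2: "h * h * ?P\<^sup>2 \<le> 1 / 4 * h * ?P\<^sup>2" using h by (intro mult_right_mono) auto
  have hP: "0 \<le> h * ?P\<^sup>2" using h by simp
  have 1: "0 \<le> ?Q\<^sup>2 / 2 - h * (?P * ?Q) + 5 / 4 * h * ?P\<^sup>2"
    using zero_le_power2[of "?Q - h * ?P"] h2 hP
    by (simp add: power2_eq_square algebra_simps)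
  have "?Q \<le> ?W + ?P" using norm_triangle_ineq4[of "p + q" p] by simp
  then have "h * (?P * ?Q) \<le> h * (?P * (?W + ?P))" using h by (intro mult_left_mono) auto
  then have 2: "0 \<le> ?W\<^sup>2 / 2 - h * (?P * ?Q) + 5 / 4 * h * ?P\<^sup>2"
    using zero_le_power2[of "?W - h * ?P"] h2 hP
    by (simp add: power2_eq_square algebra_simps)
  have "0 \<le> 2 * s * (?Q\<^sup>2 / 2 - h * (?P * ?Q) + 5 / 4 * h * ?P\<^sup>2)
      + (1 - 2 * s) * (?W\<^sup>2 / 2 - h * (?P * ?Q) + 5 / 4 * h * ?P\<^sup>2)"
    by (rule add_nonneg_nonneg; rule mult_nonneg_nonneg) (use 1 2 s in linarith)+
  also have "\<dots> = s * ?Q\<^sup>2 - s * ?W\<^sup>2 + ?W\<^sup>2 / 2 - h * (?P * ?Q) + 5 / 4 * h * ?P\<^sup>2"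
    by (simp add: field_simps)
  finally show ?thesis
    by (simp add: power2_norm_eq_inner inner_add_left inner_add_right inner_commute algebra_simps)
qed

text \<open>
  In the application \<open>r\<close> is the dual increment, \<open>n\<close> the gradient increment, \<open>Q\<close> the primal increment,
  \<open>e\<close> a step size, and \<open>D\<close> the Bregman gap. Defining the smoothness estimate \<open>l\<close> through
  \<open>n\<^sup>2 = 2 * D * l\<close> is what allows the gradient increment to be charged to \<open>D\<close>.
\<close>
lemma young_curvature_bound:
  fixes T :: real
  assumes T: "0 < T" and mu: "0 < \<mu>" and n: "n\<^sup>2 = 2 * D * l" and D: "0 \<le> D" and l: "0 \<le> l"
    and e: "0 \<le> e" and step: "e * (4 * (\<mu> * l + a\<^sup>2)) \<le> T"
  shows "e * ((a * r + n) * Q) \<le> e * (T / 2 * r\<^sup>2 + T / \<mu> * D) + Q\<^sup>2 / 4"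
proof -
  have "0 \<le> (T * r - a * Q)\<^sup>2 / (2 * T)" using T by simp
  also have "\<dots> = T / 2 * r\<^sup>2 + a\<^sup>2 * Q\<^sup>2 / (2 * T) - a * r * Q"
    using T by (simp add: power2_eq_square field_simps)
  finally have 1: "a * r * Q \<le> T / 2 * r\<^sup>2 + a\<^sup>2 * Q\<^sup>2 / (2 * T)" by simp
  have 2: "n * Q \<le> T / \<mu> * D + \<mu> * l * Q\<^sup>2 / (2 * T)"
  proof (rule power2_le_imp_le)
    let ?U = "T / \<mu> * D" and ?V = "\<mu> * l * Q\<^sup>2 / (2 * T)"
    have "(n * Q)\<^sup>2 = 4 * (?U * ?V)"
      using T mu by (simp add: power_mult_distrib n)
    also have "\<dots> \<le> (?U + ?V)\<^sup>2"
      using zero_le_power2[of "?U - ?V"] by (simp add: power2_eq_square algebra_simps)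
    finally show "(n * Q)\<^sup>2 \<le> (?U + ?V)\<^sup>2" .
    show "0 \<le> ?U + ?V" using T mu D l by simp
  qed
  have "e * ((a * r + n) * Q) \<le> e * (T / 2 * r\<^sup>2 + T / \<mu> * D + (\<mu> * l + a\<^sup>2) * Q\<^sup>2 / (2 * T))"
    using 1 2 by (intro mult_left_mono[OF _ e]) (simp add: algebra_simps add_divide_distrib)
  also have "\<dots> = e * (T / 2 * r\<^sup>2 + T / \<mu> * D) + e * (4 * (\<mu> * l + a\<^sup>2)) / (8 * T) * Q\<^sup>2"
    using T by (simp add: field_simps)
  also have "e * (4 * (\<mu> * l + a\<^sup>2)) / (8 * T) * Q\<^sup>2 \<le> 1 / 4 * Q\<^sup>2"
    using step T by (intro mult_right_mono) (simp_all add: divide_le_eq)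
  finally show ?thesis by simp
qed

text \<open>
  If no minimum existed, every point \<open>s\<close> would have a strictly better \<open>m s\<close> and, by semicontinuity, a
  neighbourhood on which \<open>h\<close> stays above \<open>h (m s)\<close>. In a finite subcover the best of the values
  \<open>h (m s)\<close> contradicts the neighbourhood that contains its own point.
\<close>
lemma lsc_attains_min:
  fixes S :: "'a::topological_space set" and h :: "'a \<Rightarrow> real"
  assumes "compact S" "S \<noteq> {}" "lsc_on S h"
  shows "\<exists>s\<in>S. \<forall>v\<in>S. h s \<le> h v"
proof (rule ccontr)
  assume "\<not> ?thesis"
  then have "\<forall>s\<in>S. \<exists>v\<in>S. h v < h s" by (auto simp: not_le)
  then obtain m where m: "\<And>s. s \<in> S \<Longrightarrow> m s \<in> S \<and> h (m s) < h s" by metis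
  have "\<exists>U. open U \<and> s \<in> U \<and> (\<forall>v\<in>U \<inter> S. h (m s) < h v)" if s: "s \<in> S" for s
  proof -
    have "\<forall>\<^sub>F v in at s within S. h (m s) < h v"
      using assms(3) s m[OF s] by (auto simp: lsc_on_def)
    then obtain U where "open U" "s \<in> U" "\<forall>v\<in>U. v \<noteq> s \<longrightarrow> v \<in> S \<longrightarrow> h (m s) < h v"
      by (auto simp: eventually_at_topological)
    then show ?thesis using m[OF s] by (intro exI[of _ U]) auto
  qed
  then obtain U where U: "\<And>s. s \<in> S \<Longrightarrow> open (U s) \<and> s \<in> U s \<and> (\<forall>v\<in>U s \<inter> S. h (m s) < h v)"
    by metis
  obtain F where F: "F \<subseteq> S" "finite F" "S \<subseteq> (\<Union>s\<in>F. U s)"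
    by (rule compactE_image[OF \<open>compact S\<close>, of S U]) (use U in blast)+
  then have "F \<noteq> {}" using \<open>S \<noteq> {}\<close> by auto
  obtain s where s: "s \<in> F" "\<And>i. i \<in> F \<Longrightarrow> h (m s) \<le> h (m i)"
    using ex_min_if_finite[of "(\<lambda>i. h (m i)) ` F"] F(2) \<open>F \<noteq> {}\<close> by (auto simp: not_less)
  then obtain i where "i \<in> F" "m s \<in> U i" using F m by blast
  then have "h (m i) < h (m s)" using U m s F by blast
  then show False using s(2)[OF \<open>i \<in> F\<close>] by simp
qed

lemma transpose_inner: "(transpose A *v d) \<bullet> c = (A *v c) \<bullet> (d :: real^'m)"
  unfolding transpose_matrix_vector dot_lmul_matrix by (rule inner_commute)

text \<open>
  The gap splits into a function of \<open>u\<close> and a function of \<open>v\<close>, so the two maximisations are independent.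
\<close>
lemma gap_Q_attains_max:
  fixes X :: "(real^'n) set" and Y :: "(real^'m) set"
  assumes X: "compact X" "X \<noteq> {}" and Y: "compact Y" "Y \<noteq> {}"
    and f: "continuous_on X f" and g: "lsc_on Y g"
  shows "\<exists>z. is_arg_max (gap_Q A f g zb) (\<lambda>z. z \<in> X \<times> Y) z"
proof -
  let ?c = "A *v fst zb"
  have "lsc_on Y (\<lambda>v. g v - ?c \<bullet> v)"
    unfolding lsc_on_def
  proof (intro ballI allI impI)
    fix v r assume v: "v \<in> Y" and r: "r < g v - ?c \<bullet> v"
    define e where "e = (g v - ?c \<bullet> v - r) / 2"
    have e: "0 < e" using r by (simp add: e_def)
    have "\<forall>\<^sub>F v' in at v within Y. g v - e < g v'"
      using g v e by (auto simp: lsc_on_def)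
    moreover have "((\<lambda>v. ?c \<bullet> v) \<longlongrightarrow> ?c \<bullet> v) (at v within Y)"
      by (intro tendsto_intros)
    then have "\<forall>\<^sub>F v' in at v within Y. ?c \<bullet> v' < ?c \<bullet> v + e"
      using e by (intro order_tendstoD(2)) auto
    ultimately show "\<forall>\<^sub>F v' in at v within Y. r < g v' - ?c \<bullet> v'"
      by eventually_elim (simp add: e_def field_simps)
  qed
  with Y obtain vm where vm: "vm \<in> Y" "\<And>v. v \<in> Y \<Longrightarrow> g vm - ?c \<bullet> vm \<le> g v - ?c \<bullet> v"
    using lsc_attains_min[of Y "\<lambda>v. g v - ?c \<bullet> v"] by blast
  have "continuous_on X (\<lambda>u. f u + (transpose A *v snd zb) \<bullet> u)"
    by (intro continuous_intros f)
  then obtain um where um: "um \<in> X"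
      "\<And>u. u \<in> X \<Longrightarrow> f um + (A *v um) \<bullet> snd zb \<le> f u + (A *v u) \<bullet> snd zb"
    using continuous_attains_inf[OF X, of "\<lambda>u. f u + (A *v u) \<bullet> snd zb"]
    unfolding transpose_inner by blast
  have "gap_Q A f g zb z \<le> gap_Q A f g zb (um, vm)" if "z \<in> X \<times> Y" for z
    using um(2)[of "fst z"] vm(2)[of "snd z"] that by (auto simp: gap_Q_def)
  then show ?thesis
    using um vm by (intro exI[of _ "(um, vm)"]) (auto simp: is_arg_max_linorder)
qed

section \<open>Primal and dual steps of the iteration\<close>

locale ac_apdhg_run = ac_stepsize_rule \<mu> \<alpha> b "LA_loc A y" "Lf_loc f df xt" \<beta> \<eta> \<tau> tt
  for X :: "(real^'n) set" and Y :: "(real^'m) set" and A :: "real^'n^'m"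
    and f :: "real^'n \<Rightarrow> real" and df :: "real^'n \<Rightarrow> real^'n" and g :: "real^'m \<Rightarrow> real"
    and Lf \<mu> \<alpha> b :: real and yt0 :: "real^'m"
    and \<beta> \<eta> \<tau> tt :: "nat \<Rightarrow> real"
    and x xt xb :: "nat \<Rightarrow> real^'n" and y :: "nat \<Rightarrow> real^'m" +
  assumes convex_X: "convex X" and convex_g: "convex_on Y g"
    and Lf_pos: "0 < Lf" and smooth: "smooth_convex_on Lf X f df"
    and run: "ac_apdhg X Y A df g \<mu> yt0 \<beta> \<eta> \<tau> tt x xt xb y"
begin

abbreviation LA :: "nat \<Rightarrow> real" where "LA \<equiv> LA_loc A y"
abbreviation LF :: "nat \<Rightarrow> real" where "LF \<equiv> Lf_loc f df xt"

text \<open>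
  The Bregman gap of \<open>f\<close> between consecutive extrapolated points, based at the newer one.
\<close>
definition breg :: "nat \<Rightarrow> real" where
  "breg t = f (xt (t - 1)) - f (xt t) - df (xt t) \<bullet> (xt (t - 1) - xt t)"

definition G :: "nat \<Rightarrow> real^'n" where
  "G t = transpose A *v y t + df (xt t)"

lemma smooth_lower:
  "u \<in> X \<Longrightarrow> v \<in> X \<Longrightarrow> 1 / (2 * Lf) * (norm (df u - df v))\<^sup>2 \<le> f v - f u - df u \<bullet> (v - u)"
  using smooth by (auto simp: smooth_convex_on_def)

lemma gradient_inequality: "u \<in> X \<Longrightarrow> v \<in> X \<Longrightarrow> f u + df u \<bullet> (v - u) \<le> f v"
proof -
  assume "u \<in> X" "v \<in> X"
  moreover have "0 \<le> 1 / (2 * Lf) * (norm (df u - df v))\<^sup>2" using Lf_pos by simp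
  ultimately show ?thesis using smooth_lower[of u v] by linarith
qed

lemma convex_f: "convex_on X f"
  using smooth by (simp add: smooth_convex_on_def)

lemma x_0: "x 0 \<in> X" and xt_0: "xt 0 = x 0" and xb_0: "xb 0 = x 0"
  using run unfolding ac_apdhg_def by blast+

lemma y_argmin_0:
  "is_arg_min (\<lambda>v. - (A *v x 0) \<bullet> v + g v + \<mu> / 2 * (norm (yt0 - v))\<^sup>2) (\<lambda>v. v \<in> Y) (y 0)"
  using run unfolding ac_apdhg_def by blast

lemma iteration:
  assumes "1 \<le> t"
  shows x_argmin: "is_arg_min
          (\<lambda>u. \<eta> t * (G (t - 1) \<bullet> u) + 1 / 2 * (norm (xb (t - 1) - u))\<^sup>2) (\<lambda>u. u \<in> X) (x t)"
    and xb_step: "xb t = (1 - \<beta> t) *\<^sub>R xb (t - 1) + \<beta> t *\<^sub>R x t"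
    and xt_step: "xt t = (1 / (1 + tt t)) *\<^sub>R (x t + tt t *\<^sub>R xt (t - 1))"
    and y_argmin: "is_arg_min
          (\<lambda>v. - (A *v x t) \<bullet> v + g v + \<mu> / 2 * (norm (yt0 - v))\<^sup>2
               + \<tau> t / 2 * (norm (y (t - 1) - v))\<^sup>2) (\<lambda>v. v \<in> Y) (y t)"
  using run assms unfolding ac_apdhg_def G_def by blast+

lemma x_in: "x t \<in> X"
  using x_0 x_argmin[of t] by (cases "t = 0") (auto simp: is_arg_min_def)

lemma y_in: "y t \<in> Y"
  using y_argmin_0 y_argmin[of t] by (cases "t = 0") (auto simp: is_arg_min_def)

lemma xb_in: "xb t \<in> X"
proof (induction t)
  case 0
  then show ?case using xb_0 x_0 by simp
next
  case (Suc t)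
  have "0 \<le> \<beta> (Suc t)" "\<beta> (Suc t) \<le> 1"
    using beta_1 beta_eq[of "Suc t"] b_pos b_less_1 by (cases "t = 0"; simp)+
  then show ?case
    using xb_step[of "Suc t"] Suc.IH x_in[of "Suc t"] convexD_alt[OF convex_X] by simp
qed

lemma Lf_loc_nonneg: "xt t \<in> X \<Longrightarrow> xt (t - 1) \<in> X \<Longrightarrow> 0 \<le> LF t"
  using gradient_inequality[of "xt t" "xt (t - 1)"] by (auto simp: Lf_loc_def)

text \<open>
  Membership in \<open>X\<close> needs a nonnegative weight \<open>tt t\<close>, hence a nonnegative \<open>\<tau> t\<close>, hence nonnegative
  smoothness estimates before \<open>t\<close>, hence membership of all earlier points: a strong induction.
\<close>
lemma xt_in: "xt t \<in> X"
proof (induction t rule: less_induct)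
  case (less t)
  show ?case
  proof (cases "t = 0")
    case True
    then show ?thesis using xt_0 x_0 by simp
  next
    case False
    have "0 \<le> \<tau> t"
    proof (cases "t = 1")
      case True
      then show ?thesis using tau_1 by simp
    next
      case False
      with \<open>t \<noteq> 0\<close> have t: "2 \<le> t" by simp
      have "\<mu> * (1 + \<alpha> * (real t - 2) / 2) \<le> \<tau> t"
        using stepsize_bounds[OF t] Lf_loc_nonneg less.IH by simp
      moreover have "0 \<le> \<mu> * (1 + \<alpha> * (real t - 2) / 2)"
        using t mu_pos alpha_pos by (intro mult_nonneg_nonneg add_nonneg_nonneg) auto
      ultimately show ?thesis by linarith
    qed
    then have tt: "0 \<le> tt t" using tt_eq[of t] False mu_pos by simp
    have "xt t = (1 - tt t / (1 + tt t)) *\<^sub>R x t + (tt t / (1 + tt t)) *\<^sub>R xt (t - 1)"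
      using xt_step[of t] False tt by (simp add: scaleR_add_right field_simps)
    also have "\<dots> \<in> X"
      using less.IH[of "t - 1"] False x_in[of t] tt by (intro convexD_alt[OF convex_X]) auto
    finally show ?thesis .
  qed
qed

sublocale ac_stepsize_nonneg \<mu> \<alpha> b LA LF \<beta> \<eta> \<tau> tt
  by unfold_locales (intro Lf_loc_nonneg xt_in)

lemma breg_nonneg: "0 \<le> breg t"
  using gradient_inequality[OF xt_in xt_in, of t "t - 1"] by (simp add: breg_def)

lemma LA_norm: "norm (transpose A *v (y t - y (t - 1))) = LA t * norm (y t - y (t - 1))"
  by (simp add: LA_loc_def)

lemma LA_nonneg: "0 \<le> LA t"
  by (simp add: LA_loc_def)

text \<open>
  A vanishing Bregman gap forces equal gradients by the lower smoothness bound, so the identity also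
  survives the convention \<open>0 / 0 = 0\<close>.
\<close>
lemma LF_breg:
  assumes "2 \<le> t"
  shows "(norm (df (xt t) - df (xt (t - 1))))\<^sup>2 = 2 * breg t * LF t"
proof (cases "breg t = 0")
  case True
  then have "1 / (2 * Lf) * (norm (df (xt t) - df (xt (t - 1))))\<^sup>2 \<le> 0"
    using smooth_lower[OF xt_in xt_in, of t "t - 1"] by (simp add: breg_def)
  then show ?thesis using True Lf_pos by (simp add: divide_le_0_iff)
next
  case False
  then show ?thesis using assms by (simp add: Lf_loc_def breg_def)
qed

lemma xt_1: "xt 1 = x 1" and xb_1: "xb 1 = x 0"
  using xt_step[of 1] tt_eq[of 1] tau_1 xb_step[of 1] beta_1 xb_0 by simp_all

lemma LF_norm: "norm (df (xt 1) - df (xt 0)) = LF 1 * norm (x 1 - x 0)"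
  using xt_0 xt_1 by (simp add: Lf_loc_def)

section \<open>Descent in the primal steps\<close>

lemma x_prox:
  assumes "1 \<le> t" "u \<in> X"
  shows "\<eta> t * (G (t - 1) \<bullet> (x t - u)) + (norm (xb (t - 1) - x t))\<^sup>2 / 2 + (norm (x t - u))\<^sup>2 / 2
    \<le> (norm (xb (t - 1) - u))\<^sup>2 / 2"
proof -
  have "convex_on X (\<lambda>u. \<eta> t * (G (t - 1) \<bullet> u))"
    using convex_X by (intro convex_onI) (auto simp: inner_add_right algebra_simps)
  from prox_three_point[OF convex_X this, of 1 "xb (t - 1)" 0 0 "x t" u] x_argmin[OF assms(1)] assms(2)
  show ?thesis by (simp add: inner_diff_right algebra_simps)
qed

lemma x_variational:
  assumes "1 \<le> t" "u \<in> X"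
  shows "(\<eta> t *\<^sub>R G (t - 1) + (x t - xb (t - 1))) \<bullet> (x t - u) \<le> 0"
proof -
  have "(norm (xb (t - 1) - u))\<^sup>2 = (norm ((xb (t - 1) - x t) + (x t - u)))\<^sup>2" by simp
  also have "\<dots> = (norm (xb (t - 1) - x t))\<^sup>2 + (norm (x t - u))\<^sup>2 + 2 * ((xb (t - 1) - x t) \<bullet> (x t - u))"
    unfolding power2_norm_eq_inner by (simp only: inner_add_left inner_add_right inner_commute)
  finally show ?thesis
    using x_prox[OF assms] by (simp add: inner_add_left inner_diff_left)
qed

text \<open>
  Expressing \<open>|x (j + 1) - u|\<^sup>2\<close> through \<open>|xb (j + 1) - u|\<^sup>2\<close> makes the distances to \<open>u\<close> telescope and
  raises the coefficient of \<open>|xb j - x (j + 1)|\<^sup>2\<close> from \<open>1 / 2\<close> to \<open>1 - b / 2\<close>.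
\<close>
lemma x_averaged_prox:
  assumes j: "1 \<le> j" and u: "u \<in> X"
  shows "\<eta> (j + 1) * (G j \<bullet> (x (j + 1) - u)) + (1 - b / 2) * (norm (xb j - x (j + 1)))\<^sup>2
    \<le> ((norm (xb j - u))\<^sup>2 - (norm (xb (j + 1) - u))\<^sup>2) / (2 * b)"
proof -
  have "xb (j + 1) - u = (1 - b) *\<^sub>R (xb j - u) + b *\<^sub>R (x (j + 1) - u)"
    using xb_step[of "j + 1"] beta_eq[of "j + 1"] j by (simp add: algebra_simps)
  moreover have "xb j - u - (x (j + 1) - u) = xb j - x (j + 1)" by simp
  ultimately have "(norm (xb (j + 1) - u))\<^sup>2 = (1 - b) * (norm (xb j - u))\<^sup>2
      + b * (norm (x (j + 1) - u))\<^sup>2 - b * (1 - b) * (norm (xb j - x (j + 1)))\<^sup>2"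
    by (simp only: norm_square_convex_combination)
  then have eq: "(norm (x (j + 1) - u))\<^sup>2 = (norm (xb j - u))\<^sup>2
      - ((norm (xb j - u))\<^sup>2 - (norm (xb (j + 1) - u))\<^sup>2) / b
      + (1 - b) * (norm (xb j - x (j + 1)))\<^sup>2"
    using b_pos by (simp add: field_simps)
  define T where "T = ((norm (xb j - u))\<^sup>2 - (norm (xb (j + 1) - u))\<^sup>2) / b"
  have "(norm (x (j + 1) - u))\<^sup>2 =
      (norm (xb j - u))\<^sup>2 - T + (1 - b) * (norm (xb j - x (j + 1)))\<^sup>2"
    using eq by (simp only: T_def)
  moreover have half_T: "((norm (xb j - u))\<^sup>2 - (norm (xb (j + 1) - u))\<^sup>2) / (2 * b) = T / 2"
    by (simp add: T_def)
  moreover have split: "(1 - b / 2) * (norm (xb j - x (j + 1)))\<^sup>2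
      = (norm (xb j - x (j + 1)))\<^sup>2 / 2 + (1 - b) * (norm (xb j - x (j + 1)))\<^sup>2 / 2"
    by (simp add: field_simps)
  moreover have "\<eta> (j + 1) * (G j \<bullet> (x (j + 1) - u)) + (norm (xb j - x (j + 1)))\<^sup>2 / 2
      + (norm (x (j + 1) - u))\<^sup>2 / 2 \<le> (norm (xb j - u))\<^sup>2 / 2"
    using x_prox[of "j + 1" u] u by simp
  ultimately show ?thesis unfolding half_T split by linarith
qed

definition lag :: "nat \<Rightarrow> real^'n" where "lag j = x j - xb j"
definition incr :: "nat \<Rightarrow> real^'n" where "incr j = x (j + 1) - x j"

text \<open>
  The division by \<open>1 - \<beta> j\<close> converts \<open>x j - xb (j - 1)\<close>, which occurs in the optimality condition, into
  \<open>lag j\<close>; the factor \<open>2\<close> anticipates the expansion of \<open>|lag j + incr j|\<^sup>2\<close>.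
\<close>
definition coupling :: "nat \<Rightarrow> real" where "coupling j = \<eta> (j + 1) / (2 * \<eta> j * (1 - \<beta> j))"

text \<open>
  The part of the surplus \<open>(1 - b / 2) * |xb j - x (j + 1)|\<^sup>2\<close> that is handed on to the next step.
\<close>
definition potential :: "nat \<Rightarrow> real" where "potential j = (1 - b) / 2 * (norm (xb j - x (j + 1)))\<^sup>2"

lemma beta_less_1: "1 \<le> j \<Longrightarrow> \<beta> j < 1"
  using beta_1 beta_eq[of j] b_less_1 by (cases "j = 1") auto

lemma lag_eq: "1 \<le> j \<Longrightarrow> lag j = (1 - \<beta> j) *\<^sub>R (x j - xb (j - 1))"
  using xb_step[of j] by (simp add: lag_def algebra_simps)

text \<open>
  The variational inequality of the step that produced \<open>x j\<close>, tested at \<open>x (j + 1)\<close> and rescaled to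
  the new step size.
\<close>
lemma old_gradient_bound:
  assumes j: "1 \<le> j"
  shows "- (2 * coupling j * (lag j \<bullet> incr j)) \<le> \<eta> (j + 1) * (G (j - 1) \<bullet> incr j)"
proof -
  have pos: "0 < \<eta> j" "0 < \<eta> (j + 1)" "0 < 1 - \<beta> j"
    using eta_pos j beta_less_1[OF j] by auto
  let ?w = "x j - xb (j - 1)"
  have "incr j = - (x j - x (j + 1))" by (simp add: incr_def)
  then have "0 \<le> (\<eta> j *\<^sub>R G (j - 1) + ?w) \<bullet> incr j"
    using x_variational[OF j x_in, of "j + 1"] by (simp only: inner_minus_right neg_0_le_iff_le)
  then have "0 \<le> \<eta> j * (G (j - 1) \<bullet> incr j) + ?w \<bullet> incr j"
    by (simp add: inner_add_left)
  then have "0 \<le> \<eta> (j + 1) / \<eta> j * (\<eta> j * (G (j - 1) \<bullet> incr j) + ?w \<bullet> incr j)"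
    using pos by (intro mult_nonneg_nonneg) auto
  also have "\<dots> = \<eta> (j + 1) * (G (j - 1) \<bullet> incr j) + 2 * coupling j * (lag j \<bullet> incr j)"
    using pos by (simp add: coupling_def lag_eq[OF j] distrib_left)
  finally show ?thesis by simp
qed

lemma x_descent:
  assumes j: "1 \<le> j" and u: "u \<in> X"
  shows "\<eta> (j + 1) * (G j \<bullet> (x j - u))
    \<le> ((norm (xb j - u))\<^sup>2 - (norm (xb (j + 1) - u))\<^sup>2) / (2 * b)
      + \<eta> (j + 1) * (norm (G j - G (j - 1)) * norm (incr j)) + 2 * coupling j * (lag j \<bullet> incr j)
      - (norm (lag j + incr j))\<^sup>2 / 2 - potential j"
proof -
  have "- ((G j - G (j - 1)) \<bullet> incr j) \<le> norm (G j - G (j - 1)) * norm (incr j)"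
    using Cauchy_Schwarz_ineq2[of "G j - G (j - 1)" "incr j"] by linarith
  then have "\<eta> (j + 1) * - ((G j - G (j - 1)) \<bullet> incr j) \<le> \<eta> (j + 1) * (norm (G j - G (j - 1)) * norm (incr j))"
    using eta_pos[of "j + 1"] by (intro mult_left_mono) auto
  moreover have "norm (xb j - x (j + 1)) = norm (lag j + incr j)"
    by (simp add: lag_def incr_def norm_minus_commute)
  moreover have "(1 - b / 2) * (norm (xb j - x (j + 1)))\<^sup>2 = (norm (xb j - x (j + 1)))\<^sup>2 / 2 + potential j"
    by (simp add: potential_def algebra_simps diff_divide_distrib)
  moreover have "\<eta> (j + 1) * (G j \<bullet> (x j - u)) = \<eta> (j + 1) * (G j \<bullet> (x (j + 1) - u))
      + \<eta> (j + 1) * - ((G j - G (j - 1)) \<bullet> incr j) - \<eta> (j + 1) * (G (j - 1) \<bullet> incr j)"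
    by (simp add: incr_def inner_diff_left inner_diff_right algebra_simps)
  ultimately show ?thesis
    using x_averaged_prox[OF j u] old_gradient_bound[OF j] by simp
qed

lemma coupling_nonneg: "1 \<le> j \<Longrightarrow> 0 \<le> coupling j"
  using eta_pos[of j] eta_pos[of "j + 1"] beta_less_1[of j] by (simp add: coupling_def)

lemma norm_G_diff: "norm (G j - G (j - 1))
    \<le> LA j * norm (y j - y (j - 1)) + norm (df (xt j) - df (xt (j - 1)))"
proof -
  have "G j - G (j - 1) = transpose A *v (y j - y (j - 1)) + (df (xt j) - df (xt (j - 1)))"
    by (simp add: G_def matrix_vector_mult_diff_distrib)
  then show ?thesis using norm_triangle_ineq by (metis LA_norm)
qed

text \<open>
  Both error terms of \<open>x_descent\<close> are paid for: the inner product by the surplus and the preceding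
  potential, since \<open>|lag j|\<^sup>2 / (2 * (1 - b)) = potential (j - 1)\<close>; the gradient difference by the
  remaining \<open>|incr j|\<^sup>2 / 4\<close> and the terms that the dual step and the convexity of \<open>f\<close> return.
\<close>
lemma primal_step:
  assumes j: "2 \<le> j" and u: "u \<in> X"
  shows "\<eta> (j + 1) * (G j \<bullet> (x j - u))
    \<le> ((norm (xb j - u))\<^sup>2 - (norm (xb (j + 1) - u))\<^sup>2) / (2 * b) + potential (j - 1) - potential j
      + \<eta> (j + 1) * (\<tau> j / 2 * (norm (y j - y (j - 1)))\<^sup>2 + \<tau> j / \<mu> * breg j)"
proof -
  have eta: "0 < \<eta> j" "0 < \<eta> (j + 1)" using eta_pos j by auto
  have "\<eta> (j + 1) \<le> (1 - b) * (2 * \<eta> j * (1 - b))"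
    using eta_ratio_le[OF j] by (simp add: power2_eq_square mult_ac)
  then have "coupling j \<le> 1 - b"
    using eta b_less_1 beta_eq[OF j] by (simp add: coupling_def pos_divide_le_eq)
  then have "(norm (incr j))\<^sup>2 / 4 + 2 * coupling j * (lag j \<bullet> incr j)
      \<le> (norm (lag j + incr j))\<^sup>2 / 2 + (norm (lag j))\<^sup>2 / (2 * (1 - b))"
    using b_pos b_less_1 coupling_nonneg[of j] j by (intro extrapolation_quadratic_bound) auto
  moreover have "(norm (lag j))\<^sup>2 / (2 * (1 - b)) = potential (j - 1)"
  proof -
    have "(c * r)\<^sup>2 / (2 * c) = c / 2 * r\<^sup>2" if "0 < c" for c r :: real
      using that by (simp add: power2_eq_square)
    moreover have "norm (lag j) = (1 - b) * norm (xb (j - 1) - x j)"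
      using lag_eq[of j] beta_eq[OF j] b_less_1 j by (simp add: norm_minus_commute)
    ultimately have "(norm (lag j))\<^sup>2 / (2 * (1 - b)) = (1 - b) / 2 * (norm (xb (j - 1) - x j))\<^sup>2"
      using b_less_1 by (simp only: diff_gt_0_iff_gt)
    then show ?thesis using j by (simp add: potential_def)
  qed
  moreover have "\<eta> (j + 1) * (norm (G j - G (j - 1)) * norm (incr j))
    \<le> \<eta> (j + 1) * ((LA j * norm (y j - y (j - 1)) + norm (df (xt j) - df (xt (j - 1)))) * norm (incr j))"
    using norm_G_diff[of j] eta by (intro mult_left_mono mult_right_mono) auto
  moreover have "\<dots> \<le> \<eta> (j + 1) * (\<tau> j / 2 * (norm (y j - y (j - 1)))\<^sup>2 + \<tau> j / \<mu> * breg j)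
      + (norm (incr j))\<^sup>2 / 4"
  proof (rule young_curvature_bound)
    show "\<eta> (j + 1) * (4 * (\<mu> * LF j + (LA j)\<^sup>2)) \<le> \<tau> j"
      using eta_curv_le[OF j] by (simp add: four_mu_curv[symmetric] distrib_left)
    show "(norm (df (xt j) - df (xt (j - 1))))\<^sup>2 = 2 * breg j * LF j" by (rule LF_breg[OF j])
  qed (use tau_pos[OF j] mu_pos breg_nonneg LF_nonneg[of j] j eta in auto)
  ultimately show ?thesis using x_descent[of j u] j u by linarith
qed

lemma dual_prox:
  assumes t: "1 \<le> t" and v: "v \<in> Y"
  shows "g (y t) - g v - (A *v x t) \<bullet> (y t - v) + \<mu> / 2 * (norm (yt0 - y t))\<^sup>2
      + \<tau> t / 2 * (norm (y t - y (t - 1)))\<^sup>2 + (\<mu> + \<tau> t) / 2 * (norm (y t - v))\<^sup>2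
    \<le> \<mu> / 2 * (norm (yt0 - v))\<^sup>2 + \<tau> t / 2 * (norm (y (t - 1) - v))\<^sup>2"
proof -
  have Y: "convex Y" using convex_g by (rule convex_on_imp_convex)
  have "convex_on Y (\<lambda>v. - (A *v x t) \<bullet> v)"
    using Y by (intro convex_onI) (auto simp: inner_add_right algebra_simps)
  then have "convex_on Y (\<lambda>v. - (A *v x t) \<bullet> v + g v)" using convex_g by (rule convex_on_add)
  from prox_three_point[OF Y this y_argmin[OF t] v]
  show ?thesis by (simp add: inner_diff_right norm_minus_commute)
qed

text \<open>
  With \<open>\<tau> 1 = 0\<close> the first two dual points solve the same \<open>\<mu>\<close>-strongly convex problem up to the
  linear term, so their distance is controlled by the change of that term.
\<close>
lemma y_first_difference: "norm (y 1 - y 0) \<le> LA 1 / \<mu> * norm (x 1 - x 0)"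
proof (cases "y 1 = y 0")
  case False
  let ?d = "norm (y 1 - y 0)"
  have Y: "convex Y" using convex_g by (rule convex_on_imp_convex)
  have "convex_on Y (\<lambda>v. - (A *v x 0) \<bullet> v)"
    using Y by (intro convex_onI) (auto simp: inner_add_right algebra_simps)
  then have "convex_on Y (\<lambda>v. - (A *v x 0) \<bullet> v + g v)" using convex_g by (rule convex_on_add)
  from prox_three_point[OF Y this, of \<mu> yt0 0 0 "y 0" "y 1"] y_argmin_0 y_in[of 1]
  have "- (A *v x 0) \<bullet> y 0 + g (y 0) + \<mu> / 2 * (norm (yt0 - y 0))\<^sup>2 + \<mu> / 2 * ?d\<^sup>2
      \<le> - (A *v x 0) \<bullet> y 1 + g (y 1) + \<mu> / 2 * (norm (yt0 - y 1))\<^sup>2"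
    by (simp add: norm_minus_commute)
  with dual_prox[of 1 "y 0"] y_in[of 0] tau_1
  have "\<mu> * ?d\<^sup>2 \<le> (A *v x 1) \<bullet> (y 1 - y 0) - (A *v x 0) \<bullet> (y 1 - y 0)"
    by (simp add: inner_diff_right)
  also have "\<dots> = (x 1 - x 0) \<bullet> (transpose A *v (y 1 - y 0))"
    unfolding inner_commute[of "x 1 - x 0"] transpose_inner
    by (simp only: matrix_vector_mult_diff_distrib inner_diff_left)
  also have "\<dots> \<le> norm (x 1 - x 0) * (LA 1 * ?d)"
    using norm_cauchy_schwarz LA_norm[of 1] by (metis diff_self_eq_0 One_nat_def)
  finally have "?d * (\<mu> * ?d) \<le> ?d * (LA 1 * norm (x 1 - x 0))"
    by (simp add: power2_eq_square mult_ac)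
  then have "\<mu> * ?d \<le> LA 1 * norm (x 1 - x 0)" using False by simp
  then show ?thesis using mu_pos by (simp add: field_simps)
qed (use LA_nonneg[of 1] mu_pos in simp)

text \<open>
  Here \<open>xb 1 = x 0\<close>, and \<open>|G 1 - G 0| \<le> curv 1 * |x 1 - x 0|\<close> because the dual increment is itself
  bounded by the primal one.
\<close>
lemma primal_first_step:
  assumes u: "u \<in> X"
  shows "\<eta> 2 * (G 1 \<bullet> (x 1 - u))
    \<le> ((norm (xb 1 - u))\<^sup>2 - (norm (xb 2 - u))\<^sup>2) / (2 * b) - potential 1
      + (5 / 4 * (\<eta> 2 * curv 1) - \<eta> 2 / (2 * \<eta> 1)) * (norm (x 1 - x 0))\<^sup>2"
proof -
  have p1: "lag 1 = x 1 - x 0" using xb_1 by (simp add: lag_def)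
  have c: "0 \<le> curv 1" using curv_nonneg[OF LF_nonneg[of 1]] by simp
  have s1: "coupling 1 = \<eta> 2 / (2 * \<eta> 1)" using beta_1 by (simp add: coupling_def numeral_2_eq_2)
  have eta: "\<eta> 2 \<le> (1 - b) * \<eta> 1" "\<eta> 2 * curv 1 \<le> 1 / 4" "0 < \<eta> 2"
    using eta_2 LF_nonneg[of 1] by auto
  have "(1 - b) * \<eta> 1 \<le> 1 * \<eta> 1" using b_pos eta1_pos by (intro mult_right_mono) auto
  with eta have "\<eta> 2 \<le> \<eta> 1" by linarith
  then have "2 * coupling 1 \<le> 1" unfolding s1 using eta1_pos by simp
  then have quad: "coupling 1 * (norm (lag 1))\<^sup>2 + \<eta> 2 * curv 1 * (norm (lag 1) * norm (incr 1))
        + 2 * coupling 1 * (lag 1 \<bullet> incr 1)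
      \<le> (norm (lag 1 + incr 1))\<^sup>2 / 2 + 5 / 4 * (\<eta> 2 * curv 1) * (norm (lag 1))\<^sup>2"
    using eta c coupling_nonneg[of 1] by (intro first_step_quadratic_bound) auto
  have "norm (G 1 - G 0) \<le> LA 1 * norm (y 1 - y 0) + LF 1 * norm (x 1 - x 0)"
    using norm_G_diff[of 1] LF_norm by simp
  also have "\<dots> \<le> LA 1 * (LA 1 / \<mu> * norm (x 1 - x 0)) + LF 1 * norm (x 1 - x 0)"
    using y_first_difference LA_nonneg[of 1] by (intro add_right_mono mult_left_mono) auto
  also have "\<dots> = curv 1 * norm (lag 1)"
    unfolding p1 by (simp add: curv_def power2_eq_square algebra_simps)
  finally have "\<eta> 2 * (norm (G 1 - G 0) * norm (incr 1)) \<le> \<eta> 2 * ((curv 1 * norm (lag 1)) * norm (incr 1))"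
    using eta by (intro mult_left_mono mult_right_mono) auto
  with quad x_descent[of 1 u] u show ?thesis
    unfolding p1[symmetric] s1[symmetric] by (simp add: algebra_simps numeral_2_eq_2)
qed

lemma primal_sum:
  assumes "1 \<le> k" and u: "u \<in> X"
  shows "(\<Sum>j=1..k. \<eta> (j + 1) * (G j \<bullet> (x j - u)))
    \<le> ((norm (x 0 - u))\<^sup>2 - (norm (xb (k + 1) - u))\<^sup>2) / (2 * b) - potential k
      + (5 / 4 * (\<eta> 2 * curv 1) - \<eta> 2 / (2 * \<eta> 1)) * (norm (x 1 - x 0))\<^sup>2
      + (\<Sum>j=1..k. \<eta> (j + 1) * (\<tau> j / 2 * (norm (y j - y (j - 1)))\<^sup>2 + \<tau> j / \<mu> * breg j))"
  using assms(1)
proof (induction k rule: nat_induct_at_least)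
  case base
  show ?case using primal_first_step[OF u] tau_1 xb_1 by (simp add: numeral_2_eq_2)
next
  case (Suc n)
  have "((norm (x 0 - u))\<^sup>2 - (norm (xb (n + 1) - u))\<^sup>2) / (2 * b)
      + ((norm (xb (n + 1) - u))\<^sup>2 - (norm (xb (n + 2) - u))\<^sup>2) / (2 * b)
      = ((norm (x 0 - u))\<^sup>2 - (norm (xb (n + 2) - u))\<^sup>2) / (2 * b)"
    by (simp add: diff_divide_distrib)
  with Suc.IH primal_step[of "n + 1" u] Suc.hyps u show ?case by simp
qed

section \<open>Summation and averaging\<close>

text \<open>
  The coefficients left after summation by parts; divided by \<open>\<mu>\<close> times the sum of the step sizes they
  are the weights of \<open>y_tilde\<close>.
\<close>
definition avg_weight :: "nat \<Rightarrow> nat \<Rightarrow> real" where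
  "avg_weight k j = (if j < k then \<eta> (j + 1) * (\<mu> + \<tau> j) - \<eta> (j + 2) * \<tau> (j + 1)
            else \<eta> (k + 1) * (\<mu> + \<tau> k))"

definition step_sum :: "nat \<Rightarrow> real" where "step_sum k = (\<Sum>t=1..k. \<eta> (t + 1))"

lemma step_sum_pos: "1 \<le> k \<Longrightarrow> 0 < step_sum k"
  unfolding step_sum_def using eta_pos by (intro sum_pos) auto

lemma avg_weight_nonneg: "1 \<le> j \<Longrightarrow> j \<le> k \<Longrightarrow> 0 \<le> avg_weight k j"
  using eta_tau_decrease[of j] eta_pos[of "k + 1"] tau_nonneg[of k] mu_pos
  by (auto simp: avg_weight_def)

text \<open>
  No boundary term at index \<open>0\<close> appears because \<open>\<tau> 1 = 0\<close>.
\<close>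
lemma summation_by_parts:
  fixes a :: "nat \<Rightarrow> 'a::real_vector"
  assumes "1 \<le> k"
  shows "(\<Sum>j=1..k. \<eta> (j + 1) *\<^sub>R ((\<mu> + \<tau> j) *\<^sub>R a j - \<tau> j *\<^sub>R a (j - 1))) = (\<Sum>j=1..k. avg_weight k j *\<^sub>R a j)"
  using assms
proof (induction k rule: nat_induct_at_least)
  case base
  then show ?case by (simp add: avg_weight_def tau_1[simplified])
next
  case (Suc n)
  have "(\<Sum>j=1..n. avg_weight (Suc n) j *\<^sub>R a j) = (\<Sum>j=1..n. avg_weight n j *\<^sub>R a j) - (\<eta> (n + 2) * \<tau> (n + 1)) *\<^sub>R a n"
    using Suc.hyps
    by (cases n) (auto simp: avg_weight_def algebra_simps intro!: sum.cong)
  with Suc show ?case by (simp add: avg_weight_def algebra_simps)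
qed

lemma avg_weight_sum: "1 \<le> k \<Longrightarrow> (\<Sum>j=1..k. avg_weight k j) = \<mu> * step_sum k"
  using summation_by_parts[of k "\<lambda>_. 1::real"]
  by (simp add: step_sum_def sum_distrib_left algebra_simps)

lemma y_tilde_eq: "1 \<le> k \<Longrightarrow> y_tilde \<mu> \<eta> \<tau> y k = (1 / (\<mu> * step_sum k)) *\<^sub>R (\<Sum>j=1..k. avg_weight k j *\<^sub>R y j)"
proof -
  assume "1 \<le> k"
  then obtain n where k: "k = Suc n" by (cases k) auto
  show ?thesis by (simp add: k y_tilde_def step_sum_def avg_weight_def)
qed

lemma x_from_xt: "1 \<le> j \<Longrightarrow> \<mu> *\<^sub>R x j = (\<mu> + \<tau> j) *\<^sub>R xt j - \<tau> j *\<^sub>R xt (j - 1)"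
proof -
  assume j: "1 \<le> j"
  have "0 \<le> tt j" using tt_eq[OF j] tau_nonneg[OF j] mu_pos by simp
  then have "(1 + tt j) *\<^sub>R xt j = x j + tt j *\<^sub>R xt (j - 1)"
    using xt_step[OF j] by simp
  then have "x j = (1 + tt j) *\<^sub>R xt j - tt j *\<^sub>R xt (j - 1)" by simp
  moreover have "\<mu> * (1 + tt j) = \<mu> + \<tau> j" "\<mu> * tt j = \<tau> j"
    using tt_eq[OF j] mu_pos by (auto simp: distrib_left)
  ultimately show ?thesis by (simp only: scaleR_diff_right scaleR_scaleR)
qed

text \<open>
  By \<open>x_from_xt\<close> the \<open>x j\<close> are the differences that summation by parts collects, so the plain average
  of the \<open>x j\<close> is the weighted average of the extrapolated points, at which \<open>f\<close> is controlled.
\<close>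
lemma ergodic_x_eq: "1 \<le> k \<Longrightarrow> ergodic_avg \<eta> x k = (1 / (\<mu> * step_sum k)) *\<^sub>R (\<Sum>j=1..k. avg_weight k j *\<^sub>R xt j)"
proof -
  assume k: "1 \<le> k"
  have "(\<Sum>j=1..k. avg_weight k j *\<^sub>R xt j) = (\<Sum>j=1..k. \<eta> (j + 1) *\<^sub>R (\<mu> *\<^sub>R x j))"
    unfolding summation_by_parts[OF k, symmetric]
    by (intro sum.cong refl) (simp only: x_from_xt atLeastAtMost_iff)
  also have "\<dots> = \<mu> *\<^sub>R (\<Sum>j=1..k. \<eta> (j + 1) *\<^sub>R x j)"
    by (simp add: scaleR_sum_right mult.commute)
  finally show ?thesis using mu_pos by (simp add: ergodic_avg_def step_sum_def)
qed

text \<open>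
  Splitting \<open>x j - u\<close> into \<open>xt j - u\<close> and a multiple of \<open>xt j - xt (j - 1)\<close>: the gradient inequality
  bounds the first part, and the second equals a difference of values plus the Bregman gap.
\<close>
lemma smooth_part_bound:
  assumes j: "1 \<le> j" and u: "u \<in> X"
  shows "((\<mu> + \<tau> j) * ((f (xt j) - f u) / \<mu>) - \<tau> j * ((f (xt (j - 1)) - f u) / \<mu>)) + \<tau> j / \<mu> * breg j
    \<le> df (xt j) \<bullet> (x j - u)"
proof -
  have "\<mu> *\<^sub>R (x j - u) = \<mu> *\<^sub>R (xt j - u) - \<tau> j *\<^sub>R (xt (j - 1) - xt j)"
    using x_from_xt[OF j] by (simp add: algebra_simps)
  then have "\<mu> * (df (xt j) \<bullet> (x j - u))
      = \<mu> * (df (xt j) \<bullet> (xt j - u)) - \<tau> j * (df (xt j) \<bullet> (xt (j - 1) - xt j))"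
    by (metis inner_diff_right inner_scaleR_right)
  moreover have "\<mu> * (f (xt j) - f u) \<le> \<mu> * (df (xt j) \<bullet> (xt j - u))"
    using gradient_inequality[OF xt_in u, of j] mu_pos by (simp add: inner_diff_right)
  ultimately have "\<mu> * (f (xt j) - f u) - \<tau> j * (f (xt (j - 1)) - f (xt j) - breg j)
      \<le> \<mu> * (df (xt j) \<bullet> (x j - u))"
    by (simp add: breg_def)
  then have "(\<mu> * (f (xt j) - f u) - \<tau> j * (f (xt (j - 1)) - f (xt j) - breg j)) / \<mu>
      \<le> df (xt j) \<bullet> (x j - u)"
    using mu_pos by (simp add: pos_divide_le_eq mult.commute)
  moreover have "(\<mu> * (f (xt j) - f u) - \<tau> j * (f (xt (j - 1)) - f (xt j) - breg j)) / \<mu>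
      = (\<mu> + \<tau> j) * ((f (xt j) - f u) / \<mu>) - \<tau> j * ((f (xt (j - 1)) - f u) / \<mu>) + \<tau> j / \<mu> * breg j"
    using mu_pos by (simp add: field_simps)
  ultimately show ?thesis by simp
qed

text \<open>
  The dual optimality condition and the bound on the smooth part, added. The cross term
  \<open>(A *v x j) \<bullet> y j\<close> cancels against the one inside \<open>G j \<bullet> (x j - u)\<close>.
\<close>
lemma one_step_gap:
  assumes j: "1 \<le> j" and u: "u \<in> X" and v: "v \<in> Y"
  shows "(A *v x j) \<bullet> v - (A *v u) \<bullet> y j + g (y j) - g v
      + \<mu> / 2 * (norm (yt0 - y j))\<^sup>2 - \<mu> / 2 * (norm (yt0 - v))\<^sup>2
      + ((\<mu> + \<tau> j) * ((norm (y j - v))\<^sup>2 / 2 + (f (xt j) - f u) / \<mu>)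
         - \<tau> j * ((norm (y (j - 1) - v))\<^sup>2 / 2 + (f (xt (j - 1)) - f u) / \<mu>))
      + (\<tau> j / 2 * (norm (y j - y (j - 1)))\<^sup>2 + \<tau> j / \<mu> * breg j)
    \<le> G j \<bullet> (x j - u)"
proof -
  have "G j \<bullet> (x j - u) = (A *v x j) \<bullet> y j - (A *v u) \<bullet> y j + df (xt j) \<bullet> (x j - u)"
    unfolding G_def inner_add_left transpose_inner
    by (simp add: matrix_vector_mult_diff_distrib inner_diff_left)
  moreover have "(\<mu> + \<tau> j) * ((norm (y j - v))\<^sup>2 / 2 + (f (xt j) - f u) / \<mu>)
      = (\<mu> + \<tau> j) / 2 * (norm (y j - v))\<^sup>2 + (\<mu> + \<tau> j) * ((f (xt j) - f u) / \<mu>)"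
    "\<tau> j * ((norm (y (j - 1) - v))\<^sup>2 / 2 + (f (xt (j - 1)) - f u) / \<mu>)
      = \<tau> j / 2 * (norm (y (j - 1) - v))\<^sup>2 + \<tau> j * ((f (xt (j - 1)) - f u) / \<mu>)"
    by (simp_all only: distrib_left)
  ultimately show ?thesis
    using dual_prox[OF j v] smooth_part_bound[OF j u] by (simp only: inner_diff_right)
qed

definition primal_bound :: "nat \<Rightarrow> real^'n \<Rightarrow> real" where
  "primal_bound k u = ((norm (x 0 - u))\<^sup>2 - (norm (xb (k + 1) - u))\<^sup>2) / b
      + \<eta> 2 * (5 * (LA 1)\<^sup>2 / (2 * \<mu>) + 5 * LF 1 / 2 - 1 / \<eta> 1) * (norm (x 1 - x 0))\<^sup>2"

text \<open>
  The terms \<open>R j\<close> that the primal sum consumes are exactly those that the dual side produces. After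
  they cancel, Jensen's inequality is applied twice: with the step sizes as weights to the convex
  terms in \<open>y j\<close>, and with \<open>avg_weight\<close> to \<open>f\<close> at the \<open>xt j\<close> and to the distances from \<open>v\<close>.
\<close>
lemma ergodic_gap_bound:
  assumes k: "1 \<le> k" and u: "u \<in> X" and v: "v \<in> Y"
  shows "gap_Q A f g (ergodic_avg \<eta> x k, ergodic_avg \<eta> y k) (u, v)
      - \<mu> / 2 * (norm (yt0 - v))\<^sup>2 + \<mu> / 2 * (norm (yt0 - ergodic_avg \<eta> y k))\<^sup>2
      + \<mu> / 2 * (norm (y_tilde \<mu> \<eta> \<tau> y k - v))\<^sup>2
    \<le> 1 / (2 * step_sum k) * primal_bound k u"
proof -
  define xh where "xh = ergodic_avg \<eta> x k"
  define yh where "yh = ergodic_avg \<eta> y k"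
  define yt where "yt = y_tilde \<mu> \<eta> \<tau> y k"
  define e where "e j = (norm (y j - v))\<^sup>2 / 2 + (f (xt j) - f u) / \<mu>" for j
  define R where "R j = \<tau> j / 2 * (norm (y j - y (j - 1)))\<^sup>2 + \<tau> j / \<mu> * breg j" for j
  define H where "H c d = (A *v c) \<bullet> v - (A *v u) \<bullet> d + g d - g v
      + \<mu> / 2 * (norm (yt0 - d))\<^sup>2 - \<mu> / 2 * (norm (yt0 - v))\<^sup>2" for c d
  have S: "0 < step_sum k" using step_sum_pos[OF k] .
  have Sx: "step_sum k *\<^sub>R xh = (\<Sum>j=1..k. \<eta> (j + 1) *\<^sub>R x j)"
    and Sy: "step_sum k *\<^sub>R yh = (\<Sum>j=1..k. \<eta> (j + 1) *\<^sub>R y j)"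
    using S by (simp_all add: xh_def yh_def ergodic_avg_def step_sum_def)
  have yh: "yh = (1 / step_sum k) *\<^sub>R (\<Sum>j=1..k. \<eta> (j + 1) *\<^sub>R y j)"
    by (simp add: yh_def ergodic_avg_def step_sum_def)
  have eta: "0 \<le> \<eta> (j + 1)" for j using eta_pos[of "j + 1"] by simp

  have "(\<Sum>j=1..k. \<eta> (j + 1) * H (x j) (y j)) + (\<Sum>j=1..k. avg_weight k j * e j) + (\<Sum>j=1..k. \<eta> (j + 1) * R j)
      = (\<Sum>j=1..k. \<eta> (j + 1) * (H (x j) (y j) + ((\<mu> + \<tau> j) * e j - \<tau> j * e (j - 1)) + R j))"
    using summation_by_parts[OF k, of e] by (simp add: sum.distrib distrib_left)
  also have "\<dots> \<le> (\<Sum>j=1..k. \<eta> (j + 1) * (G j \<bullet> (x j - u)))"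
    using one_step_gap[OF _ u v] unfolding H_def e_def R_def
    by (intro sum_mono mult_left_mono eta) (simp only: atLeastAtMost_iff)
  also have "\<dots> \<le> primal_bound k u / 2 + (\<Sum>j=1..k. \<eta> (j + 1) * R j)"
  proof -
    have "0 \<le> potential k" using b_less_1 by (simp add: potential_def)
    moreover have "5 / 4 * (\<eta> 2 * curv 1) - \<eta> 2 / (2 * \<eta> 1)
        = \<eta> 2 * (5 * (LA 1)\<^sup>2 / (2 * \<mu>) + 5 * LF 1 / 2 - 1 / \<eta> 1) / 2"
      using mu_pos eta1_pos by (simp add: curv_def field_simps)
    ultimately show ?thesis
      using primal_sum[OF k u] b_pos
      unfolding R_def primal_bound_def by (simp only: add_divide_distrib) simp
  qed
  finally have sum_bound: "(\<Sum>j=1..k. \<eta> (j + 1) * H (x j) (y j))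
        + (\<Sum>j=1..k. avg_weight k j * e j) \<le> primal_bound k u / 2"
    by simp

  have "step_sum k * H xh yh \<le> (\<Sum>j=1..k. \<eta> (j + 1) * H (x j) (y j))"
  proof -
    have g: "step_sum k * g yh \<le> (\<Sum>j=1..k. \<eta> (j + 1) * g (y j))"
      unfolding yh
      by (rule weighted_jensen(2)[OF convex_g]) (use S eta y_in in \<open>auto simp: step_sum_def\<close>)
    have n: "step_sum k * (norm (yt0 - yh))\<^sup>2 \<le> (\<Sum>j=1..k. \<eta> (j + 1) * (norm (yt0 - y j))\<^sup>2)"
      unfolding yh
      by (rule weighted_jensen(2)[OF convex_on_norm_square]) (use S eta in \<open>auto simp: step_sum_def\<close>)
    have lx: "step_sum k * ((A *v xh) \<bullet> v) = (\<Sum>j=1..k. \<eta> (j + 1) * ((A *v x j) \<bullet> v))"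
    proof -
      have "step_sum k * ((A *v xh) \<bullet> v) = (transpose A *v v) \<bullet> (step_sum k *\<^sub>R xh)"
        unfolding inner_scaleR_right transpose_inner by simp
      also have "\<dots> = (\<Sum>j=1..k. \<eta> (j + 1) * ((transpose A *v v) \<bullet> x j))"
        by (simp only: Sx inner_sum_right inner_scaleR_right)
      finally show ?thesis unfolding transpose_inner .
    qed
    have ly: "step_sum k * ((A *v u) \<bullet> yh) = (\<Sum>j=1..k. \<eta> (j + 1) * ((A *v u) \<bullet> y j))"
    proof -
      have "step_sum k * ((A *v u) \<bullet> yh) = (A *v u) \<bullet> (step_sum k *\<^sub>R yh)" by simp
      also have "\<dots> = (\<Sum>j=1..k. \<eta> (j + 1) * ((A *v u) \<bullet> y j))" by (simp add: Sy inner_sum_right)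
      finally show ?thesis .
    qed
    have "(\<Sum>j=1..k. \<eta> (j + 1) * H (x j) (y j)) = (\<Sum>j=1..k. \<eta> (j + 1) * ((A *v x j) \<bullet> v))
        - (\<Sum>j=1..k. \<eta> (j + 1) * ((A *v u) \<bullet> y j)) + (\<Sum>j=1..k. \<eta> (j + 1) * g (y j)) - step_sum k * g v
        + \<mu> / 2 * (\<Sum>j=1..k. \<eta> (j + 1) * (norm (yt0 - y j))\<^sup>2) - step_sum k * (\<mu> / 2 * (norm (yt0 - v))\<^sup>2)"
      by (simp add: H_def step_sum_def sum.distrib sum_subtractf sum_distrib_left sum_distrib_right
          algebra_simps)
    moreover have "\<mu> / 2 * (step_sum k * (norm (yt0 - yh))\<^sup>2)
        \<le> \<mu> / 2 * (\<Sum>j=1..k. \<eta> (j + 1) * (norm (yt0 - y j))\<^sup>2)"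
      using n mu_pos by (intro mult_left_mono) auto
    moreover have "step_sum k * H xh yh = step_sum k * ((A *v xh) \<bullet> v) - step_sum k * ((A *v u) \<bullet> yh) + step_sum k * g yh
        - step_sum k * g v + \<mu> / 2 * (step_sum k * (norm (yt0 - yh))\<^sup>2) - step_sum k * (\<mu> / 2 * (norm (yt0 - v))\<^sup>2)"
      by (simp add: H_def algebra_simps)
    ultimately show ?thesis using g lx ly by linarith
  qed
  moreover have "step_sum k * (f xh - f u + \<mu> / 2 * (norm (yt - v))\<^sup>2) \<le> (\<Sum>j=1..k. avg_weight k j * e j)"
  proof -
    have W: "(\<Sum>j=1..k. avg_weight k j) = \<mu> * step_sum k" "0 < \<mu> * step_sum k"
      using avg_weight_sum[OF k] S mu_pos by auto
    have f: "\<mu> * step_sum k * f xh \<le> (\<Sum>j=1..k. avg_weight k j * f (xt j))"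
      unfolding xh_def ergodic_x_eq[OF k]
      by (rule weighted_jensen(2)[OF convex_f]) (use W avg_weight_nonneg xt_in in auto)
    have n: "\<mu> * step_sum k * (norm (v - yt))\<^sup>2 \<le> (\<Sum>j=1..k. avg_weight k j * (norm (v - y j))\<^sup>2)"
      unfolding yt_def y_tilde_eq[OF k]
      by (rule weighted_jensen(2)[OF convex_on_norm_square]) (use W avg_weight_nonneg in auto)
    have "(\<Sum>j=1..k. avg_weight k j * e j) = (\<Sum>j=1..k. avg_weight k j * (norm (v - y j))\<^sup>2) / 2
        + ((\<Sum>j=1..k. avg_weight k j * f (xt j)) - (\<Sum>j=1..k. avg_weight k j) * f u) / \<mu>"
      by (simp add: e_def norm_minus_commute sum.distrib distrib_left sum_distrib_right
          right_diff_distrib sum_subtractf sum_divide_distrib diff_divide_distrib)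
    also have "\<dots> \<ge> (\<mu> * step_sum k * (norm (v - yt))\<^sup>2) / 2 + (\<mu> * step_sum k * f xh - \<mu> * step_sum k * f u) / \<mu>"
      unfolding W(1) using f n mu_pos by (intro add_mono divide_right_mono diff_right_mono) auto
    finally show ?thesis
      using mu_pos by (simp add: norm_minus_commute algebra_simps diff_divide_distrib)
  qed
  ultimately have "step_sum k * (H xh yh + f xh - f u + \<mu> / 2 * (norm (yt - v))\<^sup>2) \<le> primal_bound k u / 2"
    using sum_bound by (simp add: algebra_simps)
  then have "H xh yh + f xh - f u + \<mu> / 2 * (norm (yt - v))\<^sup>2 \<le> 1 / (2 * step_sum k) * primal_bound k u"
    using S by (simp add: field_simps)
  then show ?thesis
    by (simp add: H_def gap_Q_def xh_def yh_def yt_def)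
qed

lemma inverse_weight_bound:
  assumes "2 \<le> k"
  shows "1 / (2 * step_sum k) \<le> 12 * Lhat k / (6 * real k + \<alpha> * real k * (real k - 3))"
proof -
  let ?D = "6 * real k + \<alpha> * real k * (real k - 3)"
  have "\<alpha> * (3 - real k) \<le> \<alpha> * 1"
    using assms alpha_pos by (intro mult_left_mono) auto
  then have "0 < 6 + \<alpha> * (real k - 3)" using alpha_le by (simp add: algebra_simps)
  then have "0 < real k * (6 + \<alpha> * (real k - 3))"
    using assms by (intro mult_pos_pos) auto
  then have D: "0 < ?D" by (simp add: algebra_simps)
  then have "0 < ?D / (12 * Lhat k)" using Lhat_pos[of k] by simp
  moreover have "?D / (12 * Lhat k) \<le> 2 * step_sum k"
    using eta_sum_lower_bound[OF assms] by (simp only: step_sum_def)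
  ultimately have "1 / (2 * step_sum k) \<le> 1 / (?D / (12 * Lhat k))" by (rule frac_le[OF _ order_refl, rotated]) simp
  then show ?thesis by simp
qed

text \<open>
  The choice of \<open>\<eta> 2\<close> gives \<open>\<eta> 2 * curv 1 \<le> 1 / 4\<close>, which is where \<open>5 / 8 = 5 / 2 * (1 / 4)\<close> comes from.
\<close>
lemma primal_bound_diameter:
  assumes D: "\<And>u. u \<in> X \<Longrightarrow> (norm (u - x 0))\<^sup>2 \<le> DX\<^sup>2" and u: "u \<in> X"
  shows "primal_bound k u \<le> (1 / b + 5 / 8) * DX\<^sup>2"
proof -
  have "((norm (x 0 - u))\<^sup>2 - (norm (xb (k + 1) - u))\<^sup>2) / b \<le> DX\<^sup>2 / b"
    using D[OF u] b_pos zero_le_power2[of "norm (xb (k + 1) - u)"]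
    unfolding norm_minus_commute[of "x 0"] by (intro divide_right_mono) linarith+
  moreover have "\<eta> 2 * (5 * (LA 1)\<^sup>2 / (2 * \<mu>) + 5 * LF 1 / 2 - 1 / \<eta> 1) \<le> 5 / 8"
  proof -
    have "\<eta> 2 * (5 * (LA 1)\<^sup>2 / (2 * \<mu>) + 5 * LF 1 / 2 - 1 / \<eta> 1)
        = 5 / 2 * (\<eta> 2 * curv 1) - \<eta> 2 / \<eta> 1"
      using mu_pos eta1_pos by (simp add: curv_def field_simps)
    moreover have "\<eta> 2 * curv 1 \<le> 1 / 4" "0 \<le> \<eta> 2 / \<eta> 1"
      using eta_2[OF LF_nonneg[of 1]] eta1_pos by auto
    ultimately show ?thesis by linarith
  qed
  then have "\<eta> 2 * (5 * (LA 1)\<^sup>2 / (2 * \<mu>) + 5 * LF 1 / 2 - 1 / \<eta> 1) * (norm (x 1 - x 0))\<^sup>2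
      \<le> 5 / 8 * DX\<^sup>2"
    using D[OF x_in[of 1]] by (intro mult_mono) auto
  ultimately have "primal_bound k u \<le> DX\<^sup>2 / b + 5 / 8 * DX\<^sup>2"
    unfolding primal_bound_def by (rule add_mono)
  then show ?thesis by (simp add: distrib_right)
qed

end

section \<open>Convergence rate\<close>

theorem corollary4p3:
  fixes X :: "(real^'n) set" and Y :: "(real^'m) set" and A :: "real^'n^'m"
    and f :: "real^'n \<Rightarrow> real" and df :: "real^'n \<Rightarrow> real^'n" and g :: "real^'m \<Rightarrow> real"
    and Lf \<mu> \<alpha> b :: real and yt0 :: "real^'m"
    and \<beta> \<eta> \<tau> tt :: "nat \<Rightarrow> real"
    and x xt xb :: "nat \<Rightarrow> real^'n" and y :: "nat \<Rightarrow> real^'m"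
  defines "LA \<equiv> LA_loc A y"
    and "LF \<equiv> Lf_loc f df xt"
    and "Lh \<equiv> L_hat \<mu> b (\<eta> 1) (LA_loc A y) (Lf_loc f df xt)"
    and "xh \<equiv> ergodic_avg \<eta> x"
    and "yh \<equiv> ergodic_avg \<eta> y"
    and "yt \<equiv> y_tilde \<mu> \<eta> \<tau> y"
  assumes "X \<noteq> {}" "closed X" "convex X"
    and "Y \<noteq> {}" "closed Y" "convex Y"
    and "convex_on Y g" "lsc_on Y g"
    and "Lf > 0" "smooth_convex_on Lf X f df"
    and "\<exists>xs ys. saddle_point X Y (lagrangian A f g) xs ys"
    and "\<mu> > 0"
    and "0 < \<alpha>" "\<alpha> \<le> 1"
    and "0 < b" "b \<le> 1 - sqrt 6 / 3"
    and "ac_apdhg X Y A df g \<mu> yt0 \<beta> \<eta> \<tau> tt x xt xb y"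
    and "ac_stepsizes \<mu> \<alpha> b LA LF \<beta> \<eta> \<tau> tt"
  shows "(\<forall>t\<ge>2. \<eta> t \<ge> (3 + \<alpha> * (real t - 3)) / (12 * Lh (t - 1))) \<and>
    (\<forall>k\<ge>2. \<forall>u\<in>X. \<forall>v\<in>Y.
       (let C = 12 * Lh k / (6 * real k + \<alpha> * real k * (real k - 3));
            B = ((norm (x 0 - u))\<^sup>2 - (norm (xb (k + 1) - u))\<^sup>2) / b
                + \<eta> 2 * (5 * (LA 1)\<^sup>2 / (2 * \<mu>) + 5 * LF 1 / 2 - 1 / \<eta> 1) * (norm (x 1 - x 0))\<^sup>2
        in gap_Q A f g (xh k, yh k) (u, v)
             - \<mu> / 2 * (norm (yt0 - v))\<^sup>2 + \<mu> / 2 * (norm (yt0 - yh k))\<^sup>2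
             + \<mu> / 2 * (norm (yt k - v))\<^sup>2
           \<le> (if 0 \<le> B then C else 1 / (2 * (\<Sum>t=1..k. \<eta> (t + 1)))) * B)) \<and>
    (\<forall>DX DY. (\<forall>u\<in>X. (norm (u - x 0))\<^sup>2 \<le> DX\<^sup>2) \<and> (\<forall>v\<in>Y. (norm (v - yt0))\<^sup>2 \<le> DY\<^sup>2) \<longrightarrow>
       (\<forall>k\<ge>2. \<exists>z. is_arg_max (gap_Q A f g (xh k, yh k)) (\<lambda>z. z \<in> X \<times> Y) z \<and>
          gap_Q A f g (xh k, yh k) z
          \<le> 12 * Lh k / (6 * real k + \<alpha> * real k * (real k - 3)) * (1 / b + 5 / 8) * DX\<^sup>2
             + \<mu> / 2 * DY\<^sup>2))"
proof -
  interpret ac_apdhg_run X Y A f df g Lf \<mu> \<alpha> b yt0 \<beta> \<eta> \<tau> tt x xt xb y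
    by unfold_locales (use assms in auto)
  have Lh: "Lh = Lhat" by (simp add: Lh_def)
  have S: "(\<Sum>t=1..k. \<eta> (t + 1)) = step_sum k" for k by (simp only: step_sum_def)
  let ?C = "\<lambda>k. 12 * Lhat k / (6 * real k + \<alpha> * real k * (real k - 3))"
  have B: "((norm (x 0 - u))\<^sup>2 - (norm (xb (k + 1) - u))\<^sup>2) / b
      + \<eta> 2 * (5 * (LA 1)\<^sup>2 / (2 * \<mu>) + 5 * LF 1 / 2 - 1 / \<eta> 1) * (norm (x 1 - x 0))\<^sup>2 = primal_bound k u" for k u
    by (simp only: primal_bound_def LA_def LF_def)
  have bound: "gap_Q A f g (xh k, yh k) (u, v)
      - \<mu> / 2 * (norm (yt0 - v))\<^sup>2 + \<mu> / 2 * (norm (yt0 - yh k))\<^sup>2 + \<mu> / 2 * (norm (yt k - v))\<^sup>2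
      \<le> (if 0 \<le> primal_bound k u then ?C k else 1 / (2 * step_sum k)) * primal_bound k u"
    if k: "2 \<le> k" and u: "u \<in> X" and v: "v \<in> Y" for k u v
  proof -
    (* Enlarging the factor is legitimate only for a nonnegative bound. *)
    have scale: "1 / (2 * step_sum k) * primal_bound k u
        \<le> (if 0 \<le> primal_bound k u then ?C k else 1 / (2 * step_sum k)) * primal_bound k u"
      using inverse_weight_bound[OF k] by (auto intro: mult_right_mono simp del: times_divide_eq_left)
    have "1 \<le> k" using k by simp
    from order_trans[OF ergodic_gap_bound[OF this u v] scale] show ?thesis
      by (simp only: xh_def yh_def yt_def)
  qed
  have diameter: "\<exists>z. is_arg_max (gap_Q A f g (xh k, yh k)) (\<lambda>z. z \<in> X \<times> Y) z \<and>
      gap_Q A f g (xh k, yh k) z \<le> ?C k * (1 / b + 5 / 8) * DX\<^sup>2 + \<mu> / 2 * DY\<^sup>2"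
    if DX: "\<forall>u\<in>X. (norm (u - x 0))\<^sup>2 \<le> DX\<^sup>2" and DY: "\<forall>v\<in>Y. (norm (v - yt0))\<^sup>2 \<le> DY\<^sup>2"
      and k: "2 \<le> k" for DX DY k
  proof -
    have "X \<subseteq> cball (x 0) \<bar>DX\<bar>" "Y \<subseteq> cball yt0 \<bar>DY\<bar>"
      using DX DY by (auto simp: dist_norm norm_minus_commute simp flip: abs_le_square_iff)
    then have "bounded X" "bounded Y"
      by (blast intro: bounded_subset[OF bounded_cball])+
    then have "compact X" "compact Y"
      using \<open>closed X\<close> \<open>closed Y\<close> by (simp_all add: compact_eq_bounded_closed)
    moreover have "continuous_on X f"
      using smooth by (auto simp: smooth_convex_on_def intro!: has_derivative_continuous_on)
    ultimately obtain z where z: "is_arg_max (gap_Q A f g (xh k, yh k)) (\<lambda>z. z \<in> X \<times> Y) z"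
      using gap_Q_attains_max[OF _ \<open>X \<noteq> {}\<close> _ \<open>Y \<noteq> {}\<close> _ \<open>lsc_on Y g\<close>] by blast
    then obtain u v where uv: "z = (u, v)" "u \<in> X" "v \<in> Y" by (auto simp: is_arg_max_def)
    have C: "0 \<le> ?C k"
    proof -
      have "0 \<le> 1 / (2 * step_sum k)" using step_sum_pos[of k] k by simp
      also note inverse_weight_bound[OF k]
      finally show ?thesis .
    qed
    have "(if 0 \<le> primal_bound k u then ?C k else 1 / (2 * step_sum k)) * primal_bound k u
        \<le> ?C k * ((1 / b + 5 / 8) * DX\<^sup>2)"
    proof (cases "0 \<le> primal_bound k u")
      case True
      then show ?thesis
        using mult_left_mono[OF primal_bound_diameter[of DX u k] C] DX uv by simp
    next
      case False
      then have "1 / (2 * step_sum k) * primal_bound k u \<le> 0"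
        using step_sum_pos[of k] k by (intro mult_nonneg_nonpos) auto
      also have "0 \<le> ?C k * ((1 / b + 5 / 8) * DX\<^sup>2)"
        using C b_pos by (intro mult_nonneg_nonneg) auto
      finally show ?thesis using False by simp
    qed
    moreover have "\<mu> / 2 * (norm (yt0 - v))\<^sup>2 \<le> \<mu> / 2 * DY\<^sup>2"
      using DY uv mu_pos by (intro mult_left_mono) (auto simp: norm_minus_commute)
    moreover have "0 \<le> \<mu> / 2 * (norm (yt0 - yh k))\<^sup>2" "0 \<le> \<mu> / 2 * (norm (yt k - v))\<^sup>2"
      using mu_pos by auto
    ultimately have "gap_Q A f g (xh k, yh k) (u, v) \<le> ?C k * ((1 / b + 5 / 8) * DX\<^sup>2) + \<mu> / 2 * DY\<^sup>2"
      using bound[OF k uv(2,3)] by linarith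
    then show ?thesis using z uv by (intro exI[of _ z]) (simp only: mult.assoc simp_thms)
  qed
  show ?thesis
    unfolding Let_def B S Lh
    using eta_lower_bound bound diameter by blast
qed

end
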